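(* Let $\mathbb{K}\in\{\mathbb{R},\mathbb{C}\}$, let $0\to\mathfrak{n}\to\widehat{\mathfrak{g}}\xrightarrow{q}\mathfrak{g}\to 0$ be an extension of Lie algebras over $\mathbb{K}$, let $V$ be a $\mathfrak{g}$-module, also regarded as a $\widehat{\mathfrak{g}}$-module via $x.v:=q(x).v$, and let $\sigma:\mathfrak{g}\to\widehat{\mathfrak{g}}$ be a linear section of $q$. Let $p\in\mathbb{N}_0$, and let $\mathrm{Sym}^p(\mathfrak{n},V)^{\widehat{\mathfrak{g}}}$ be the set of symmetric $p$-linear maps $f:\mathfrak{n}^p\to V$ with $$x.f(y_1,\ldots,y_p)=\sum_{i=1}^p f(y_1,\ldots,[\sigma(x),y_i],\ldots,y_p)\qquad\text{for all }x\in\mathfrak{g},\ y_1,\ldots,y_p\in\mathfrak{n}.$$ For every $f\in\mathrm{Sym}^p(\mathfrak{n},V)^{\widehat{\mathfrak{g}}}$ one has $d_{\mathfrak{g}}(\Delta_f(\sigma))=0$; hence the cochain $\Delta_f(\sigma)\in C^{2p}(\mathfrak{g},V)$ is a cocycle and defines an element of the Lie algebra cohomology space $H^{2p}(\mathfrak{g},V)$. Furthermore, for each $p\in\mathbb{N}_0$ the assignment $f\mapsto\Delta_f(\sigma)$ induces a map $$[\Delta(\sigma)]:\mathrm{Sym}^p(\mathfrak{n},V)^{\widehat{\mathfrak{g}}}\to H^{2p}(\mathfrak{g},V),\qquad f\mapsto[\Delta_f(\sigma)].$$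
   Context: All vector spaces are over $\mathbb{K}$. $C^p(\mathfrak{g},W)=\mathrm{Alt}^p(\mathfrak{g},W)$ denotes the space of alternating $p$-linear maps $\mathfrak{g}^p\to W$. The Chevalley--Eilenberg differential $d_{\mathfrak{g}}:C^p(\mathfrak{g},V)\to C^{p+1}(\mathfrak{g},V)$ is $$d_{\mathfrak{g}}\omega(x_0,\ldots,x_p)=\sum_{j=0}^p(-1)^jx_j.\omega(x_0,\ldots,\widehat{x}_j,\ldots,x_p)+\sum_{i<j}(-1)^{i+j}\omega([x_i,x_j],x_0,\ldots,\widehat{x}_i,\ldots,\widehat{x}_j,\ldots,x_p),$$ and $H^p(\mathfrak{g},V)=\ker(d_{\mathfrak{g}}|_{C^p})/d_{\mathfrak{g}}(C^{p-1}(\mathfrak{g},V))$ (with zero coboundaries for $p=0$). Wedge product: for a bilinear map $m:V_1\times V_2\to V_3$, $\alpha\in\mathrm{Alt}^p(\mathfrak{g},V_1)$, $\beta\in\mathrm{Alt}^q(\mathfrak{g},V_2)$, $$(\alpha\wedge_m\beta)(x_1,\ldots,x_{p+q})=\frac{1}{p!q!}\sum_{\tau\in S_{p+q}}\mathrm{sgn}(\tau)\,m\big(\alpha(x_{\tau(1)},\ldots,x_{\tau(p)}),\beta(x_{\tau(p+1)},\ldots,x_{\tau(p+q)})\big).$$ $\wedge_{\otimes_s}$ is the wedge product for the multiplication $S^a(\mathfrak{n})\times S^b(\mathfrak{n})\to S^{a+b}(\mathfrak{n})$, $(x,y)\mapsto x\otimes_s y$, of the symmetric algebra (so $S^1(\mathfrak{n})=\mathfrak{n}$,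 and the empty product is $1\in S^0(\mathfrak{n})=\mathbb{K}$). For a symmetric $p$-linear map $f:\mathfrak{n}^p\to V$, $\tilde f:S^p(\mathfrak{n})\to V$ is the linear map with $\tilde f(y_1\otimes_s\cdots\otimes_s y_p)=f(y_1,\ldots,y_p)$. The curvature of the linear section $\sigma$ of $q$ is $R_\sigma\in C^2(\mathfrak{g},\mathfrak{n})$, $R_\sigma(x,y)=[\sigma(x),\sigma(y)]-\sigma([x,y])$, and $$\Delta_f(\sigma):=\tilde f\circ(\underbrace{R_\sigma\wedge_{\otimes_s}\cdots\wedge_{\otimes_s}R_\sigma}_{p})\in C^{2p}(\mathfrak{g},V).$$ *)

theory Defs
  imports
    Complex_Main
    "HOL-Library.FuncSet"
    "HOL-Library.Set_Algebras"
    "HOL-Library.Poly_Mapping"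
    "HOL-Library.Multiset"
    "HOL-Combinatorics.Permutations"
begin

(* A field belongs to this class iff it is isomorphic to the reals or to the complex numbers. *)
class real_or_complex = field_char_0 +
  assumes real_or_complex:
    "(\<exists>h :: 'a \<Rightarrow> real. bij h \<and> (\<forall>x y. h (x + y) = h x + h y \<and> h (x * y) = h x * h y)) \<or>
     (\<exists>h :: 'a \<Rightarrow> complex. bij h \<and> (\<forall>x y. h (x + y) = h x + h y \<and> h (x * y) = h x * h y))"

instance real :: real_or_complex
  by standard (rule disjI1, rule exI[of _ id], simp)

instance complex :: real_or_complex
  by standard (rule disjI2, rule exI[of _ id], simp)


section \<open>Lie algebras, modules and extensions\<close>

locale lie_algebra = vector_space scale
  for scale :: "'k::field \<Rightarrow> 'a::ab_group_add \<Rightarrow> 'a" +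
  fixes bracket :: "'a \<Rightarrow> 'a \<Rightarrow> 'a"
  assumes bracket_linear_right: "Vector_Spaces.linear scale scale (\<lambda>y. bracket x y)"
    and bracket_linear_left: "Vector_Spaces.linear scale scale (\<lambda>x. bracket x y)"
    and bracket_self: "bracket x x = 0"
    and jacobi: "bracket x (bracket y z) + bracket y (bracket z x) + bracket z (bracket x y) = 0"

locale lie_module = lie_algebra scale bracket
  for scale :: "'k::field \<Rightarrow> 'g::ab_group_add \<Rightarrow> 'g" and bracket :: "'g \<Rightarrow> 'g \<Rightarrow> 'g" +
  fixes scale_v :: "'k \<Rightarrow> 'v::ab_group_add \<Rightarrow> 'v" and act :: "'g \<Rightarrow> 'v \<Rightarrow> 'v"
  assumes act_linear_right: "Vector_Spaces.linear scale_v scale_v (\<lambda>v. act x v)"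
    and act_linear_left: "Vector_Spaces.linear scale scale_v (\<lambda>x. act x v)"
    and act_bracket: "act (bracket x y) v = act x (act y v) - act y (act x v)"

locale lie_hom =
  dom: lie_algebra scale1 bracket1 + cod: lie_algebra scale2 bracket2
  for scale1 :: "'k::field \<Rightarrow> 'a::ab_group_add \<Rightarrow> 'a" and bracket1 :: "'a \<Rightarrow> 'a \<Rightarrow> 'a"
    and scale2 :: "'k \<Rightarrow> 'b::ab_group_add \<Rightarrow> 'b" and bracket2 :: "'b \<Rightarrow> 'b \<Rightarrow> 'b" +
  fixes h :: "'a \<Rightarrow> 'b"
  assumes hom_linear: "Vector_Spaces.linear scale1 scale2 h"
    and hom_bracket: "h (bracket1 x y) = bracket2 (h x) (h y)"

locale lie_extension =
  incl: lie_hom scale_n bracket_n scale_e bracket_e \<iota> +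
  proj: lie_hom scale_e bracket_e scale_g bracket_g q
  for scale_n :: "'k::field \<Rightarrow> 'n::ab_group_add \<Rightarrow> 'n" and bracket_n :: "'n \<Rightarrow> 'n \<Rightarrow> 'n"
    and scale_e :: "'k \<Rightarrow> 'e::ab_group_add \<Rightarrow> 'e" and bracket_e :: "'e \<Rightarrow> 'e \<Rightarrow> 'e"
    and scale_g :: "'k \<Rightarrow> 'g::ab_group_add \<Rightarrow> 'g" and bracket_g :: "'g \<Rightarrow> 'g \<Rightarrow> 'g"
    and \<iota> :: "'n \<Rightarrow> 'e" and q :: "'e \<Rightarrow> 'g" +
  assumes inj_incl: "inj \<iota>"
    and exact: "range \<iota> = {z. q z = 0}"
    and surj_proj: "surj q"

definition linear_section ::
  "('k::field \<Rightarrow> 'g::ab_group_add \<Rightarrow> 'g) \<Rightarrow> ('k \<Rightarrow> 'e::ab_group_add \<Rightarrow> 'e) \<Rightarrow> ('e \<Rightarrow> 'g) \<Rightarrow> ('g \<Rightarrow> 'e) \<Rightarrow> bool"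
  where "linear_section scale_g scale_e q \<sigma> \<longleftrightarrow>
    Vector_Spaces.linear scale_g scale_e \<sigma> \<and> (\<forall>x. q (\<sigma> x) = x)"


section \<open>Multilinear maps and Lie algebra cohomology\<close>

text \<open>
  A map of \<open>p\<close> arguments is a function on lists. It is required to vanish on lists of any other
  length, so that equality of functions is equality of \<open>p\<close>-linear maps.
\<close>

definition multilinear_maps ::
  "('k::field \<Rightarrow> 'a::ab_group_add \<Rightarrow> 'a) \<Rightarrow> ('k \<Rightarrow> 'w::ab_group_add \<Rightarrow> 'w) \<Rightarrow> nat \<Rightarrow> ('a list \<Rightarrow> 'w) set"
  where "multilinear_maps scale_a scale_w p =
    {f. (\<forall>xs. length xs \<noteq> p \<longrightarrow> f xs = 0) \<and>
        (\<forall>xs i. length xs = p \<and> i < p \<longrightarrow> Vector_Spaces.linear scale_a scale_w (\<lambda>x. f (xs[i := x])))}"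

definition alternating_maps ::
  "('k::field \<Rightarrow> 'a::ab_group_add \<Rightarrow> 'a) \<Rightarrow> ('k \<Rightarrow> 'w::ab_group_add \<Rightarrow> 'w) \<Rightarrow> nat \<Rightarrow> ('a list \<Rightarrow> 'w) set"
  where "alternating_maps scale_a scale_w p =
    {f \<in> multilinear_maps scale_a scale_w p.
       \<forall>xs i j. length xs = p \<and> i < j \<and> j < p \<and> xs ! i = xs ! j \<longrightarrow> f xs = 0}"

definition symmetric_maps ::
  "('k::field \<Rightarrow> 'a::ab_group_add \<Rightarrow> 'a) \<Rightarrow> ('k \<Rightarrow> 'w::ab_group_add \<Rightarrow> 'w) \<Rightarrow> nat \<Rightarrow> ('a list \<Rightarrow> 'w) set"
  where "symmetric_maps scale_a scale_w p =
    {f \<in> multilinear_maps scale_a scale_w p.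
       \<forall>xs \<tau>. length xs = p \<and> \<tau> permutes {..<p} \<longrightarrow> f (permute_list \<tau> xs) = f xs}"

text \<open>
  \<open>nths xs (- J)\<close> is the list \<open>xs\<close> with the entries at the positions in \<open>J\<close> omitted. The degree of
  the cochain does not occur: for a cochain \<open>\<omega>\<close> of degree \<open>p\<close>, both sums vanish unless
  \<open>length xs = p + 1\<close>.
\<close>

definition ce_differential ::
  "('g \<Rightarrow> 'g \<Rightarrow> 'g) \<Rightarrow> ('k::field \<Rightarrow> 'v::ab_group_add \<Rightarrow> 'v) \<Rightarrow> ('g \<Rightarrow> 'v \<Rightarrow> 'v)
    \<Rightarrow> ('g list \<Rightarrow> 'v) \<Rightarrow> 'g list \<Rightarrow> 'v"
  where "ce_differential bracket_g scale_v act \<omega> xs =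
    (\<Sum>j<length xs. scale_v ((-1) ^ j) (act (xs ! j) (\<omega> (nths xs (- {j}))))) +
    (\<Sum>j<length xs. \<Sum>i<j. scale_v ((-1) ^ (i + j))
        (\<omega> (bracket_g (xs ! i) (xs ! j) # nths xs (- {i, j}))))"

definition cocycles ::
  "('k::field \<Rightarrow> 'g::ab_group_add \<Rightarrow> 'g) \<Rightarrow> ('g \<Rightarrow> 'g \<Rightarrow> 'g) \<Rightarrow> ('k \<Rightarrow> 'v::ab_group_add \<Rightarrow> 'v)
    \<Rightarrow> ('g \<Rightarrow> 'v \<Rightarrow> 'v) \<Rightarrow> nat \<Rightarrow> ('g list \<Rightarrow> 'v) set"
  where "cocycles scale_g bracket_g scale_v act p =
    {\<omega> \<in> alternating_maps scale_g scale_v p. ce_differential bracket_g scale_v act \<omega> = (\<lambda>_. 0)}"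

definition coboundaries ::
  "('k::field \<Rightarrow> 'g::ab_group_add \<Rightarrow> 'g) \<Rightarrow> ('g \<Rightarrow> 'g \<Rightarrow> 'g) \<Rightarrow> ('k \<Rightarrow> 'v::ab_group_add \<Rightarrow> 'v)
    \<Rightarrow> ('g \<Rightarrow> 'v \<Rightarrow> 'v) \<Rightarrow> nat \<Rightarrow> ('g list \<Rightarrow> 'v) set"
  where "coboundaries scale_g bracket_g scale_v act p =
    (case p of 0 \<Rightarrow> {\<lambda>_. 0}
     | Suc p' \<Rightarrow> ce_differential bracket_g scale_v act ` alternating_maps scale_g scale_v p')"

definition cohomologous ::
  "('k::field \<Rightarrow> 'g::ab_group_add \<Rightarrow> 'g) \<Rightarrow> ('g \<Rightarrow> 'g \<Rightarrow> 'g) \<Rightarrow> ('k \<Rightarrow> 'v::ab_group_add \<Rightarrow> 'v)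
    \<Rightarrow> ('g \<Rightarrow> 'v \<Rightarrow> 'v) \<Rightarrow> nat \<Rightarrow> (('g list \<Rightarrow> 'v) \<times> ('g list \<Rightarrow> 'v)) set"
  where "cohomologous scale_g bracket_g scale_v act p =
    {(\<alpha>, \<beta>). \<alpha> \<in> cocycles scale_g bracket_g scale_v act p \<and>
             \<beta> \<in> cocycles scale_g bracket_g scale_v act p \<and>
             (\<lambda>xs. \<alpha> xs - \<beta> xs) \<in> coboundaries scale_g bracket_g scale_v act p}"

definition cohomology ::
  "('k::field \<Rightarrow> 'g::ab_group_add \<Rightarrow> 'g) \<Rightarrow> ('g \<Rightarrow> 'g \<Rightarrow> 'g) \<Rightarrow> ('k \<Rightarrow> 'v::ab_group_add \<Rightarrow> 'v)
    \<Rightarrow> ('g \<Rightarrow> 'v \<Rightarrow> 'v) \<Rightarrow> nat \<Rightarrow> ('g list \<Rightarrow> 'v) set set"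
  where "cohomology scale_g bracket_g scale_v act p =
    cocycles scale_g bracket_g scale_v act p // cohomologous scale_g bracket_g scale_v act p"

definition cohomology_class ::
  "('k::field \<Rightarrow> 'g::ab_group_add \<Rightarrow> 'g) \<Rightarrow> ('g \<Rightarrow> 'g \<Rightarrow> 'g) \<Rightarrow> ('k \<Rightarrow> 'v::ab_group_add \<Rightarrow> 'v)
    \<Rightarrow> ('g \<Rightarrow> 'v \<Rightarrow> 'v) \<Rightarrow> nat \<Rightarrow> ('g list \<Rightarrow> 'v) \<Rightarrow> ('g list \<Rightarrow> 'v) set"
  where "cohomology_class scale_g bracket_g scale_v act p \<omega> =
    cohomologous scale_g bracket_g scale_v act p `` {\<omega>}"

text \<open>
  The wedge product of maps of \<open>p\<close> and \<open>q\<close> arguments along \<open>m\<close>; only its values on lists of length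
  \<open>p + q\<close> are meaningful. The target is merely a commutative monoid with a scaling function, so that
  it can be the symmetric algebra below, whose elements are cosets.
\<close>

definition wedge ::
  "('k::field_char_0 \<Rightarrow> 'c::comm_monoid_add \<Rightarrow> 'c) \<Rightarrow> ('a \<Rightarrow> 'b \<Rightarrow> 'c) \<Rightarrow> nat \<Rightarrow> nat
    \<Rightarrow> ('g list \<Rightarrow> 'a) \<Rightarrow> ('g list \<Rightarrow> 'b) \<Rightarrow> 'g list \<Rightarrow> 'c"
  where "wedge scale_c m p q \<alpha> \<beta> xs =
    scale_c (1 / (fact p * fact q))
      (\<Sum>\<tau> | \<tau> permutes {..<p + q}. scale_c (of_int (sign \<tau>))
         (m (\<alpha> (take p (permute_list \<tau> xs))) (\<beta> (drop p (permute_list \<tau> xs)))))"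


section \<open>The symmetric algebra\<close>

text \<open>
  \<open>'n multiset \<Rightarrow>\<^sub>0 'k\<close> is the polynomial ring over \<open>'k\<close> with one variable for each vector \<open>y\<close>, the
  variable being \<open>single {#y#} 1\<close>. The symmetric algebra is its quotient by the ideal generated by
  the relations that make \<open>y \<mapsto> single {#y#} 1\<close> linear. Its elements are the cosets \<open>P +o I\<close>
  of this ideal \<open>I\<close>, added as sets. The neutral element \<open>{0}\<close> of set addition is not a coset, but a
  sum of cosets over a nonempty finite index set, such as the permutations in \<open>wedge\<close>, is the sum
  in the quotient.
\<close>

definition sym_ideal ::
  "('k::field \<Rightarrow> 'n::ab_group_add \<Rightarrow> 'n) \<Rightarrow> ('n multiset \<Rightarrow>\<^sub>0 'k) set"
  where "sym_ideal scale = module.span (*)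
    ({Poly_Mapping.single {#x + y#} 1 - Poly_Mapping.single {#x#} 1 - Poly_Mapping.single {#y#} 1 | x y. True} \<union>
     {Poly_Mapping.single {#scale c x#} 1 - Poly_Mapping.single {#x#} c | c x. True})"

definition sym_power ::
  "('k::field \<Rightarrow> 'n::ab_group_add \<Rightarrow> 'n) \<Rightarrow> nat \<Rightarrow> ('n multiset \<Rightarrow>\<^sub>0 'k) set set"
  where "sym_power scale p =
    {P +o sym_ideal scale | P. \<forall>M \<in> Poly_Mapping.keys P. size M = p}"

definition sym_scale ::
  "('k::field \<Rightarrow> 'n::ab_group_add \<Rightarrow> 'n) \<Rightarrow> 'k \<Rightarrow> ('n multiset \<Rightarrow>\<^sub>0 'k) set \<Rightarrow> ('n multiset \<Rightarrow>\<^sub>0 'k) set"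
  where "sym_scale scale c A = Poly_Mapping.single {#} c *o A + sym_ideal scale"

definition sym_mult ::
  "('k::field \<Rightarrow> 'n::ab_group_add \<Rightarrow> 'n)
    \<Rightarrow> ('n multiset \<Rightarrow>\<^sub>0 'k) set \<Rightarrow> ('n multiset \<Rightarrow>\<^sub>0 'k) set \<Rightarrow> ('n multiset \<Rightarrow>\<^sub>0 'k) set"
  where "sym_mult scale A B = A * B + sym_ideal scale"

definition sym_one ::
  "('k::field \<Rightarrow> 'n::ab_group_add \<Rightarrow> 'n) \<Rightarrow> ('n multiset \<Rightarrow>\<^sub>0 'k) set"
  where "sym_one scale = 1 +o sym_ideal scale"

definition sym_incl ::
  "('k::field \<Rightarrow> 'n::ab_group_add \<Rightarrow> 'n) \<Rightarrow> 'n \<Rightarrow> ('n multiset \<Rightarrow>\<^sub>0 'k) set"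
  where "sym_incl scale y = Poly_Mapping.single {#y#} 1 +o sym_ideal scale"

definition sym_product ::
  "('k::field \<Rightarrow> 'n::ab_group_add \<Rightarrow> 'n) \<Rightarrow> 'n list \<Rightarrow> ('n multiset \<Rightarrow>\<^sub>0 'k) set"
  where "sym_product scale ys = foldr (\<lambda>y. sym_mult scale (sym_incl scale y)) ys (sym_one scale)"

definition is_sym_lift ::
  "('k::field \<Rightarrow> 'n::ab_group_add \<Rightarrow> 'n) \<Rightarrow> ('k \<Rightarrow> 'v::ab_group_add \<Rightarrow> 'v) \<Rightarrow> nat
    \<Rightarrow> ('n list \<Rightarrow> 'v) \<Rightarrow> (('n multiset \<Rightarrow>\<^sub>0 'k) set \<Rightarrow> 'v) \<Rightarrow> bool"
  where "is_sym_lift scale_n scale_v p f \<phi> \<longleftrightarrow>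
    (\<forall>A \<in> sym_power scale_n p. \<forall>B \<in> sym_power scale_n p. \<phi> (A + B) = \<phi> A + \<phi> B) \<and>
    (\<forall>c. \<forall>A \<in> sym_power scale_n p. \<phi> (sym_scale scale_n c A) = scale_v c (\<phi> A)) \<and>
    (\<forall>ys. length ys = p \<longrightarrow> \<phi> (sym_product scale_n ys) = f ys) \<and>
    (\<forall>A. A \<notin> sym_power scale_n p \<longrightarrow> \<phi> A = 0)"

definition sym_lift ::
  "('k::field \<Rightarrow> 'n::ab_group_add \<Rightarrow> 'n) \<Rightarrow> ('k \<Rightarrow> 'v::ab_group_add \<Rightarrow> 'v) \<Rightarrow> nat
    \<Rightarrow> ('n list \<Rightarrow> 'v) \<Rightarrow> ('n multiset \<Rightarrow>\<^sub>0 'k) set \<Rightarrow> 'v"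
  where "sym_lift scale_n scale_v p f = (THE \<phi>. is_sym_lift scale_n scale_v p f \<phi>)"


text \<open>
  Every symmetric map factors uniquely through the symmetric power, so that \<open>sym_lift\<close> is well defined.
\<close>

interpretation poly_ideal: module "(*) :: ('n multiset \<Rightarrow>\<^sub>0 'k::field) \<Rightarrow> _ \<Rightarrow> _"
  by standard (simp_all add: algebra_simps)

lemma sym_coset_eq_iff: "P +o sym_ideal s = Q +o sym_ideal s \<longleftrightarrow> P - Q \<in> sym_ideal s"
proof
  assume "P +o sym_ideal s = Q +o sym_ideal s"
  moreover have "P \<in> P +o sym_ideal s"
    using poly_ideal.span_zero by (force simp: elt_set_plus_def sym_ideal_def)
  ultimately show "P - Q \<in> sym_ideal s"
    by (auto simp: elt_set_plus_def)
next
  assume PQ: "P - Q \<in> sym_ideal s"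
  have *: "X +o sym_ideal s \<subseteq> Y +o sym_ideal s" if "X - Y \<in> sym_ideal s" for X Y
  proof
    fix Z assume "Z \<in> X +o sym_ideal s"
    then obtain b where b: "b \<in> sym_ideal s" "Z = X + b" by (auto simp: elt_set_plus_def)
    have "(X - Y) + b \<in> sym_ideal s"
      using that b by (simp add: sym_ideal_def poly_ideal.span_add)
    moreover have "Z = Y + ((X - Y) + b)" using b by simp
    ultimately show "Z \<in> Y +o sym_ideal s" unfolding elt_set_plus_def by blast
  qed
  have "Q - P \<in> sym_ideal s"
    using poly_ideal.span_neg[OF PQ[unfolded sym_ideal_def]] by (simp add: sym_ideal_def)
  with * PQ show "P +o sym_ideal s = Q +o sym_ideal s" by blast
qed

lemma sym_coset_add:
  "(P +o sym_ideal s) + (Q +o sym_ideal s) = (P + Q) +o sym_ideal s"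
proof
  show "(P +o sym_ideal s) + (Q +o sym_ideal s) \<subseteq> (P + Q) +o sym_ideal s"
  proof
    fix Z assume "Z \<in> (P +o sym_ideal s) + (Q +o sym_ideal s)"
    then obtain a b where ab: "a \<in> sym_ideal s" "b \<in> sym_ideal s" "Z = (P + a) + (Q + b)"
      by (auto simp: elt_set_plus_def set_plus_def)
    have "Z = (P + Q) + (a + b)" "a + b \<in> sym_ideal s"
      using ab by (simp_all add: sym_ideal_def poly_ideal.span_add ac_simps)
    then show "Z \<in> (P + Q) +o sym_ideal s" by (auto simp: elt_set_plus_def)
  qed
next
  show "(P + Q) +o sym_ideal s \<subseteq> (P +o sym_ideal s) + (Q +o sym_ideal s)"
  proof
    fix Z assume "Z \<in> (P + Q) +o sym_ideal s"
    then obtain a where a: "a \<in> sym_ideal s" "Z = (P + a) + (Q + 0)"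
      by (auto simp: elt_set_plus_def ac_simps)
    have "0 \<in> sym_ideal s" by (simp add: sym_ideal_def poly_ideal.span_zero)
    with a show "Z \<in> (P +o sym_ideal s) + (Q +o sym_ideal s)"
      unfolding elt_set_plus_def set_plus_def by blast
  qed
qed

lemma sym_mult_coset:
  "sym_mult s (P +o sym_ideal s) (Q +o sym_ideal s) = (P * Q) +o sym_ideal s"
proof
  show "sym_mult s (P +o sym_ideal s) (Q +o sym_ideal s) \<subseteq> (P * Q) +o sym_ideal s"
  proof
    fix Z assume "Z \<in> sym_mult s (P +o sym_ideal s) (Q +o sym_ideal s)"
    then obtain a b c where abc: "a \<in> sym_ideal s" "b \<in> sym_ideal s" "c \<in> sym_ideal s"
      "Z = (P + a) * (Q + b) + c"
      by (auto simp: sym_mult_def elt_set_plus_def set_plus_def set_times_def)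
    have "Z = P * Q + ((P + a) * b + Q * a + c)"
      using abc by (simp add: algebra_simps)
    moreover have "(P + a) * b + Q * a + c \<in> sym_ideal s"
      using abc by (simp add: sym_ideal_def poly_ideal.span_add poly_ideal.span_scale)
    ultimately show "Z \<in> (P * Q) +o sym_ideal s" by (auto simp: elt_set_plus_def)
  qed
next
  have 0: "0 \<in> sym_ideal s" by (simp add: sym_ideal_def poly_ideal.span_zero)
  show "(P * Q) +o sym_ideal s \<subseteq> sym_mult s (P +o sym_ideal s) (Q +o sym_ideal s)"
  proof
    fix Z assume "Z \<in> (P * Q) +o sym_ideal s"
    then obtain a where a: "a \<in> sym_ideal s" "Z = (P + 0) * (Q + 0) + a"
      by (auto simp: elt_set_plus_def)
    then show "Z \<in> sym_mult s (P +o sym_ideal s) (Q +o sym_ideal s)"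
      using 0 unfolding sym_mult_def elt_set_plus_def set_plus_def set_times_def by blast
  qed
qed

lemma sym_scale_coset:
  "sym_scale s c (P +o sym_ideal s) = (Poly_Mapping.single {#} c * P) +o sym_ideal s"
proof
  show "sym_scale s c (P +o sym_ideal s) \<subseteq> (Poly_Mapping.single {#} c * P) +o sym_ideal s"
  proof
    fix Z assume "Z \<in> sym_scale s c (P +o sym_ideal s)"
    then obtain a b where ab: "a \<in> sym_ideal s" "b \<in> sym_ideal s"
      "Z = Poly_Mapping.single {#} c * (P + a) + b"
      by (auto simp: sym_scale_def elt_set_plus_def elt_set_times_def set_plus_def)
    have "Z = Poly_Mapping.single {#} c * P + (Poly_Mapping.single {#} c * a + b)"
      using ab by (simp add: algebra_simps)
    moreover have "Poly_Mapping.single {#} c * a + b \<in> sym_ideal s"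
      using ab by (simp add: sym_ideal_def poly_ideal.span_add poly_ideal.span_scale)
    ultimately show "Z \<in> (Poly_Mapping.single {#} c * P) +o sym_ideal s"
      by (auto simp: elt_set_plus_def)
  qed
next
  have 0: "0 \<in> sym_ideal s" by (simp add: sym_ideal_def poly_ideal.span_zero)
  show "(Poly_Mapping.single {#} c * P) +o sym_ideal s \<subseteq> sym_scale s c (P +o sym_ideal s)"
  proof
    fix Z assume "Z \<in> (Poly_Mapping.single {#} c * P) +o sym_ideal s"
    then obtain a where a: "a \<in> sym_ideal s" "Z = Poly_Mapping.single {#} c * (P + 0) + a"
      by (auto simp: elt_set_plus_def)
    then show "Z \<in> sym_scale s c (P +o sym_ideal s)"
      using 0 unfolding sym_scale_def elt_set_plus_def elt_set_times_def set_plus_def by blast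
  qed
qed

lemma sym_product_coset:
  "sym_product s ys = Poly_Mapping.single (mset ys) 1 +o sym_ideal s"
proof (induction ys)
  case Nil
  then show ?case by (simp add: sym_product_def sym_one_def)
next
  case (Cons y ys)
  then show ?case
    by (simp add: sym_product_def sym_incl_def sym_mult_coset mult_single)
qed

lemma poly_mapping_single_induct:
  fixes P :: "'a \<Rightarrow>\<^sub>0 'b::ab_group_add"
  assumes "Q 0"
    and "\<And>P M c. Q P \<Longrightarrow> M \<notin> Poly_Mapping.keys P \<Longrightarrow> c \<noteq> 0 \<Longrightarrow> Q (Poly_Mapping.single M c + P)"
  shows "Q P"
proof (induction "card (Poly_Mapping.keys P)" arbitrary: P)
  case 0
  then show ?case using assms(1) by simp
next
  case (Suc n)
  then obtain M where M: "M \<in> Poly_Mapping.keys P" by (metis card.empty nat.distinct(1) ex_in_conv)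
  let ?c = "Poly_Mapping.lookup P M" and ?P = "P - Poly_Mapping.single M (Poly_Mapping.lookup P M)"
  have k: "Poly_Mapping.keys ?P = Poly_Mapping.keys P - {M}"
    by (auto simp: in_keys_iff lookup_minus lookup_single when_def split: if_splits)
  have "Q ?P" using Suc k M by simp
  moreover have "M \<notin> Poly_Mapping.keys ?P" "?c \<noteq> 0"
    using k M by (auto simp: in_keys_iff)
  ultimately have "Q (Poly_Mapping.single M ?c + ?P)" by (rule assms(2))
  then show ?case by simp
qed

lemma is_sym_lift_unique:
  assumes \<phi>: "is_sym_lift scale_n scale_v p f \<phi>" and \<psi>: "is_sym_lift scale_n scale_v p f \<psi>"
    and V: "vector_space scale_v"
  shows "\<phi> = \<psi>"
proof
  fix A
  interpret vector_space scale_v by (rule V)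
  let ?I = "sym_ideal scale_n"
  have single: "Poly_Mapping.single M c +o ?I \<in> sym_power scale_n p
      \<and> \<phi> (Poly_Mapping.single M c +o ?I) = \<psi> (Poly_Mapping.single M c +o ?I)"
    if "size M = p" for M c
  proof -
    obtain ys where ys: "mset ys = M" using ex_mset by blast
    have mem: "Poly_Mapping.single M c +o ?I \<in> sym_power scale_n p" for c
      unfolding sym_power_def using that by (auto split: if_splits)
    have "sym_scale scale_n c (sym_product scale_n ys) = Poly_Mapping.single M c +o ?I"
      by (simp add: sym_product_coset sym_scale_coset mult_single ys)
    moreover have "sym_product scale_n ys \<in> sym_power scale_n p"
      by (simp add: sym_product_coset ys mem)
    moreover have "length ys = p" using ys that by (metis size_mset)
    ultimately show ?thesis using \<phi> \<psi> mem unfolding is_sym_lift_def by metis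
  qed
  have zero: "\<phi> ((0 :: _ multiset \<Rightarrow>\<^sub>0 _) +o ?I) = 0" if "is_sym_lift scale_n scale_v p f \<phi>" for \<phi>
  proof -
    have mem: "0 +o ?I \<in> sym_power scale_n p"
      unfolding sym_power_def by (rule CollectI, rule exI[of _ 0]) simp
    have "sym_scale scale_n 0 (0 +o ?I) = 0 +o ?I" by (simp only: sym_scale_coset) simp
    then show ?thesis using that mem unfolding is_sym_lift_def by (metis scale_zero_left)
  qed
  have "(\<forall>M \<in> Poly_Mapping.keys P. size M = p) \<longrightarrow> \<phi> (P +o ?I) = \<psi> (P +o ?I)" for P
  proof (induction P rule: poly_mapping_single_induct)
    case 1
    show ?case using zero[OF \<phi>] zero[OF \<psi>] by simp
  next
    case (2 P M c)
    show ?case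
    proof
      assume h: "\<forall>M' \<in> Poly_Mapping.keys (Poly_Mapping.single M c + P). size M' = p"
      have k: "Poly_Mapping.keys (Poly_Mapping.single M c + P) = insert M (Poly_Mapping.keys P)"
        using 2 by (auto simp: in_keys_iff lookup_add lookup_single when_def split: if_splits)
      have P: "P +o ?I \<in> sym_power scale_n p" unfolding sym_power_def using h k by blast
      have "size M = p" using h k by blast
      note s = single[OF this, of c]
      have "\<phi> (P +o ?I) = \<psi> (P +o ?I)" using 2 h k by blast
      then show "\<phi> ((Poly_Mapping.single M c + P) +o ?I) = \<psi> ((Poly_Mapping.single M c + P) +o ?I)"
        using \<phi> \<psi> P s unfolding is_sym_lift_def sym_coset_add[symmetric] by metis
    qed
  qed
  then show "\<phi> A = \<psi> A"
    using \<phi> \<psi> unfolding is_sym_lift_def sym_power_def by (cases "A \<in> sym_power scale_n p") (auto simp: sym_power_def)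
qed

lemma is_sym_lift_exists:
  assumes f: "f \<in> symmetric_maps scale_n scale_v p"
    and N: "vector_space scale_n" and V: "vector_space scale_v"
  shows "\<exists>\<phi>. is_sym_lift scale_n scale_v p f \<phi>"
proof -
  interpret V: vector_space scale_v by (rule V)
  let ?I = "sym_ideal scale_n"
  define F where "F M = f (SOME ys. mset ys = M)" for M
  define \<Phi> where "\<Phi> P = (\<Sum>M \<in> Poly_Mapping.keys P. scale_v (Poly_Mapping.lookup P M) (F M))" for P
  have F: "F (mset ys) = f ys" for ys
  proof -
    define zs where "zs = (SOME zs. mset zs = mset ys)"
    have zs: "mset zs = mset ys" unfolding zs_def by (rule someI[of _ ys]) simp
    then obtain \<tau> where \<tau>: "\<tau> permutes {..<length ys}" "permute_list \<tau> ys = zs"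
      by (rule mset_eq_permutation)
    have "f zs = f ys"
    proof (cases "length ys = p")
      case True
      then show ?thesis using f \<tau> unfolding symmetric_maps_def by blast
    next
      case False
      then have "length zs \<noteq> p" using zs by (metis size_mset)
      then show ?thesis using f False unfolding symmetric_maps_def multilinear_maps_def by simp
    qed
    then show ?thesis by (simp add: F_def zs_def)
  qed
  have linF: "F (add_mset (x + y) M) = F (add_mset x M) + F (add_mset y M)"
    "F (add_mset (scale_n c x) M) = scale_v c (F (add_mset x M))" for x y c M
  proof -
    obtain ys where ys: "mset ys = M" using ex_mset by blast
    have Fx: "F (add_mset z M) = f (z # ys)" for z using F[of "z # ys"] ys by simp
    have "f ((x + y) # ys) = f (x # ys) + f (y # ys) \<and> f (scale_n c x # ys) = scale_v c (f (x # ys))"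
    proof (cases "Suc (length ys) = p")
      case True
      have "Vector_Spaces.linear scale_n scale_v (\<lambda>z. f ((x # ys)[0 := z]))"
      proof -
        have "\<forall>xs i. length xs = p \<and> i < p \<longrightarrow> Vector_Spaces.linear scale_n scale_v (\<lambda>z. f (xs[i := z]))"
          using f unfolding symmetric_maps_def multilinear_maps_def by blast
        from this[rule_format, of "x # ys" 0] True show ?thesis by auto
      qed
      then interpret L: Vector_Spaces.linear scale_n scale_v "\<lambda>z. f (z # ys)" by simp
      show ?thesis by (simp add: L.add L.scale)
    next
      case False
      then show ?thesis using f unfolding symmetric_maps_def multilinear_maps_def by simp
    qed
    then show "F (add_mset (x + y) M) = F (add_mset x M) + F (add_mset y M)"
      "F (add_mset (scale_n c x) M) = scale_v c (F (add_mset x M))" by (simp_all add: Fx)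
  qed
  have sup: "\<Phi> P = (\<Sum>M \<in> S. scale_v (Poly_Mapping.lookup P M) (F M))"
    if "finite S" "Poly_Mapping.keys P \<subseteq> S" for P S
    unfolding \<Phi>_def using that by (intro sum.mono_neutral_left) (auto simp: in_keys_iff)
  have add: "\<Phi> (P + Q) = \<Phi> P + \<Phi> Q" for P Q
  proof -
    let ?S = "Poly_Mapping.keys P \<union> Poly_Mapping.keys Q"
    have "Poly_Mapping.keys (P + Q) \<subseteq> ?S" by (rule keys_add)
    then show ?thesis
      by (simp add: sup[of ?S] lookup_add V.scale_left_distrib sum.distrib)
  qed
  have single: "\<Phi> (Poly_Mapping.single M c) = scale_v c (F M)" for M c
    by (simp add: sup[of "{M}"])
  have zero: "\<Phi> 0 = 0" by (simp add: \<Phi>_def)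
  have diff: "\<Phi> (P - Q) = \<Phi> P - \<Phi> Q" for P Q
    using add[of "P - Q" Q] by simp
  have rel1: "\<Phi> (P * (Poly_Mapping.single {#x + y#} 1 - Poly_Mapping.single {#x#} 1 - Poly_Mapping.single {#y#} 1)) = 0"
    for P x y
    by (induction P rule: poly_mapping_single_induct)
      (simp_all add: zero add diff single linF mult_single algebra_simps)
  have rel2: "\<Phi> (P * (Poly_Mapping.single {#scale_n c x#} 1 - Poly_Mapping.single {#x#} c)) = 0"
    for P c x
    by (induction P rule: poly_mapping_single_induct)
      (simp_all add: zero add diff single linF mult_single algebra_simps)
  have I: "\<Phi> P = 0" if "P \<in> ?I" for P
    using that unfolding sym_ideal_def
    by (induction rule: poly_ideal.span_induct_alt) (auto simp: zero add rel1 rel2)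
  have scale: "\<Phi> (Poly_Mapping.single {#} c * P) = scale_v c (\<Phi> P)" for c P
    by (induction P rule: poly_mapping_single_induct)
      (simp_all add: zero add single mult_single algebra_simps V.scale_right_distrib)
  define \<phi> where "\<phi> A = (if A \<in> sym_power scale_n p then \<Phi> (SOME P. P +o ?I = A) else 0)" for A
  have \<phi>: "\<phi> (P +o ?I) = \<Phi> P" if "P +o ?I \<in> sym_power scale_n p" for P
  proof -
    define Q where "Q = (SOME Q. Q +o ?I = P +o ?I)"
    have "Q +o ?I = P +o ?I" unfolding Q_def by (rule someI[of _ P]) simp
    then have "\<Phi> (Q - P) = 0" by (intro I) (simp add: sym_coset_eq_iff)
    then show ?thesis using that by (simp add: \<phi>_def Q_def diff)
  qed
  have closed: "(P + Q) +o ?I \<in> sym_power scale_n p" "(Poly_Mapping.single {#} c * P) +o ?I \<in> sym_power scale_n p"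
    if "\<forall>M \<in> Poly_Mapping.keys P. size M = p" "\<forall>M \<in> Poly_Mapping.keys Q. size M = p" for P Q c
  proof -
    show "(P + Q) +o ?I \<in> sym_power scale_n p"
      unfolding sym_power_def using that keys_add[of P Q] by blast
    have "Poly_Mapping.keys (Poly_Mapping.single {#} c * P) \<subseteq> Poly_Mapping.keys P"
      using keys_mult[of "Poly_Mapping.single {#} c" P] by (auto split: if_splits)
    then show "(Poly_Mapping.single {#} c * P) +o ?I \<in> sym_power scale_n p"
      unfolding sym_power_def using that by blast
  qed
  have "is_sym_lift scale_n scale_v p f \<phi>"
    unfolding is_sym_lift_def
  proof (intro conjI ballI allI impI)
    fix A B assume A: "A \<in> sym_power scale_n p" and B: "B \<in> sym_power scale_n p"
    then obtain P Q where "A = P +o ?I" "\<forall>M \<in> Poly_Mapping.keys P. size M = p"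
      "B = Q +o ?I" "\<forall>M \<in> Poly_Mapping.keys Q. size M = p" unfolding sym_power_def by blast
    then show "\<phi> (A + B) = \<phi> A + \<phi> B"
      using A B closed(1)[of P Q] by (simp add: sym_coset_add \<phi> add)
  next
    fix c A assume A: "A \<in> sym_power scale_n p"
    then obtain P where "A = P +o ?I" "\<forall>M \<in> Poly_Mapping.keys P. size M = p"
      unfolding sym_power_def by blast
    then show "\<phi> (sym_scale scale_n c A) = scale_v c (\<phi> A)"
      using A closed(2)[of P P c] by (simp add: sym_scale_coset \<phi> scale)
  next
    fix ys :: "'a list" assume "length ys = p"
    then have "Poly_Mapping.single (mset ys) 1 +o ?I \<in> sym_power scale_n p"
      unfolding sym_power_def by (auto intro!: exI[of _ "Poly_Mapping.single (mset ys) 1"])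
    then show "\<phi> (sym_product scale_n ys) = f ys"
      by (simp add: sym_product_coset \<phi> single F)
  qed (simp add: \<phi>_def)
  then show ?thesis by blast
qed

lemma is_sym_lift_sym_lift:
  assumes "f \<in> symmetric_maps scale_n scale_v p" "vector_space scale_n" "vector_space scale_v"
  shows "is_sym_lift scale_n scale_v p f (sym_lift scale_n scale_v p f)"
  unfolding sym_lift_def
  using is_sym_lift_exists[OF assms] is_sym_lift_unique[OF _ _ assms(3)]
  by (metis (no_types, lifting) theI)


section \<open>Curvature and the characteristic cochains\<close>

text \<open>
  The kernel of \<open>q\<close> is identified with \<open>'n\<close> by \<open>inv \<iota>\<close>.
\<close>

definition invariant_symmetric_maps ::
  "('k::field \<Rightarrow> 'n::ab_group_add \<Rightarrow> 'n) \<Rightarrow> ('e \<Rightarrow> 'e \<Rightarrow> 'e) \<Rightarrow> ('n \<Rightarrow> 'e)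
    \<Rightarrow> ('k \<Rightarrow> 'v::ab_group_add \<Rightarrow> 'v) \<Rightarrow> ('g \<Rightarrow> 'v \<Rightarrow> 'v) \<Rightarrow> ('g \<Rightarrow> 'e) \<Rightarrow> nat \<Rightarrow> ('n list \<Rightarrow> 'v) set"
  where "invariant_symmetric_maps scale_n bracket_e \<iota> scale_v act \<sigma> p =
    {f \<in> symmetric_maps scale_n scale_v p.
       \<forall>x ys. length ys = p \<longrightarrow>
         act x (f ys) = (\<Sum>i<p. f (ys[i := inv \<iota> (bracket_e (\<sigma> x) (\<iota> (ys ! i)))]))}"

definition curvature ::
  "('e::ab_group_add \<Rightarrow> 'e \<Rightarrow> 'e) \<Rightarrow> ('g \<Rightarrow> 'g \<Rightarrow> 'g) \<Rightarrow> ('n \<Rightarrow> 'e) \<Rightarrow> ('g \<Rightarrow> 'e) \<Rightarrow> 'g \<Rightarrow> 'g \<Rightarrow> 'n"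
  where "curvature bracket_e bracket_g \<iota> \<sigma> x y =
    inv \<iota> (bracket_e (\<sigma> x) (\<sigma> y) - \<sigma> (bracket_g x y))"

fun curvature_power ::
  "('k::field_char_0 \<Rightarrow> 'n::ab_group_add \<Rightarrow> 'n) \<Rightarrow> ('e::ab_group_add \<Rightarrow> 'e \<Rightarrow> 'e) \<Rightarrow> ('g \<Rightarrow> 'g \<Rightarrow> 'g)
    \<Rightarrow> ('n \<Rightarrow> 'e) \<Rightarrow> ('g \<Rightarrow> 'e) \<Rightarrow> nat \<Rightarrow> 'g list \<Rightarrow> ('n multiset \<Rightarrow>\<^sub>0 'k) set"
  where
    "curvature_power scale_n bracket_e bracket_g \<iota> \<sigma> 0 = (\<lambda>_. sym_one scale_n)"
  | "curvature_power scale_n bracket_e bracket_g \<iota> \<sigma> (Suc p) =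
      wedge (sym_scale scale_n) (sym_mult scale_n) (2 * p) 2
        (curvature_power scale_n bracket_e bracket_g \<iota> \<sigma> p)
        (\<lambda>xs. sym_incl scale_n (curvature bracket_e bracket_g \<iota> \<sigma> (xs ! 0) (xs ! 1)))"

definition delta_cochain ::
  "('k::field_char_0 \<Rightarrow> 'n::ab_group_add \<Rightarrow> 'n) \<Rightarrow> ('e::ab_group_add \<Rightarrow> 'e \<Rightarrow> 'e) \<Rightarrow> ('g \<Rightarrow> 'g \<Rightarrow> 'g)
    \<Rightarrow> ('n \<Rightarrow> 'e) \<Rightarrow> ('k \<Rightarrow> 'v::ab_group_add \<Rightarrow> 'v) \<Rightarrow> ('g \<Rightarrow> 'e) \<Rightarrow> nat \<Rightarrow> ('n list \<Rightarrow> 'v) \<Rightarrow> 'g list \<Rightarrow> 'v"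
  where "delta_cochain scale_n bracket_e bracket_g \<iota> scale_v \<sigma> p f xs =
    (if length xs = 2 * p
     then sym_lift scale_n scale_v p f (curvature_power scale_n bracket_e bracket_g \<iota> \<sigma> p xs)
     else 0)"

end

(*
  Expanding the wedge products gives
    Delta_f(sigma) = 2^(-p) * Alt(f(R(x_1, x_2), ..., R(x_(2p-1), x_(2p)))),
  where Alt is the signed sum over all permutations of the arguments. In d(Delta_f(sigma)) the first
  sum is the alternation of x_0.f(R(x_1, x_2), ...), which by the invariance and the symmetry of f is p
  times that of f([sigma x_0, R(x_1, x_2)], R(x_3, x_4), ...); the second sum is -p times the
  alternation of f(R([x_0, x_1], x_2), R(x_3, x_4), ...). The difference vanishes because the
  alternation is unchanged under the even permutation x_0 -> x_1 -> x_2 -> x_0, and the cyclic sum of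
  [sigma x, R(y, z)] - R([x, y], z) is zero (the Bianchi identity).
*)

theory Submission
  imports Defs
begin

section \<open>Permutations and omitted arguments\<close>

text \<open>The factor 2^(-p) arises because each further wedge factor brings 1/((2k)! 2!), while
  the nested alternation over the first 2k arguments gives (2k)! back. The coefficient -p of the
  second sum has two sources. The bracket, which the differential puts first, can land in any of the
  2p slots inside the alternation, and all slots contribute equally by the antisymmetry of the
  curvature and the symmetry of f; on the other hand, the pairs i < j are only half of the ordered
  pairs of arguments. To avoid dividing, that sum is evaluated after doubling it. For p = 0 there is
  no factor to which the Bianchi identity could apply: f is a single vector, and invariance says
  that the action annihilates it. Elements of the symmetric algebra are cosets added as sets, and
  sets under addition do not form a group. The wedge powers are therefore expanded on polynomial
  representatives, and the lift of f is evaluated on the resulting combination of monomials.\<close>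

definition suc_perm :: "(nat \<Rightarrow> nat) \<Rightarrow> nat \<Rightarrow> nat"
  where "suc_perm q = case_nat 0 (\<lambda>i. Suc (q i))"

lemma suc_perm_simps [simp]: "suc_perm q 0 = 0" "suc_perm q (Suc i) = Suc (q i)"
  by (simp_all add: suc_perm_def)

text \<open>Makes the library facts on membership and sign for \<open>map_permutation\<close>
  available.\<close>

lemma suc_perm_eq_map_permutation:
  assumes "q permutes {..<n}"
  shows "suc_perm q = map_permutation {..<n} Suc q"
proof
  fix i
  show "suc_perm q i = map_permutation {..<n} Suc q i"
  proof (cases "i \<in> Suc ` {..<n}")
    case True
    then show ?thesis by (auto simp: map_permutation_apply)
  next
    case False
    then have "map_permutation {..<n} Suc q i = i"
      by (simp add: map_permutation_def restrict_id_def)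
    moreover have "suc_perm q i = i"
      using False permutes_not_in[OF assms] by (cases i) auto
    ultimately show ?thesis by simp
  qed
qed

lemma suc_perm_permutes:
  assumes "q permutes {..<n}"
  shows "suc_perm q permutes {..<Suc n}"
proof -
  have "map_permutation {..<n} Suc q permutes Suc ` {..<n}"
    using assms by (intro map_permutation_permutes) (auto simp: bij_betw_def)
  then show ?thesis
    unfolding suc_perm_eq_map_permutation[OF assms] by (rule permutes_subset) auto
qed

lemma sign_suc_perm: "q permutes {..<n} \<Longrightarrow> sign (suc_perm q) = sign q"
  by (simp add: suc_perm_eq_map_permutation sign_map_permutation)

lemma inv_suc_perm:
  assumes "q permutes {..<n}"
  shows "inv (suc_perm q) = suc_perm (inv q)"
proof (rule inv_unique_comp)
  show "suc_perm q \<circ> suc_perm (inv q) = id" "suc_perm (inv q) \<circ> suc_perm q = id"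
    by (auto simp: fun_eq_iff suc_perm_def permutes_inverses[OF assms] split: nat.split)
qed

lemma sign_compose_permutes:
  "finite S \<Longrightarrow> p permutes S \<Longrightarrow> q permutes S \<Longrightarrow> sign (p \<circ> q) = sign p * sign q"
  by (simp add: sign_compose permutes_imp_permutation)

text \<open>Here \<open>c k\<close> is any transversal of the cosets of the stabiliser of \<open>0\<close>.\<close>

lemma sum_permutations_Suc:
  assumes c: "\<And>k. k < Suc n \<Longrightarrow> c k permutes {..<Suc n}" "\<And>k. k < Suc n \<Longrightarrow> c k 0 = k"
  shows "(\<Sum>\<tau> | \<tau> permutes {..<Suc n}. h \<tau>) = (\<Sum>k<Suc n. \<Sum>q | q permutes {..<n}. h (c k \<circ> suc_perm q))"
proof -
  let ?A = "{..<Suc n} \<times> {q. q permutes {..<n}}" and ?B = "{\<tau>. \<tau> permutes {..<Suc n}}"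
  define g where "g = (\<lambda>(k, q). c k \<circ> suc_perm q)"
  have inj: "inj_on g ?A"
  proof (rule inj_onI)
    fix a b assume a: "a \<in> ?A" and b: "b \<in> ?A" and e: "g a = g b"
    obtain k q k' q' where ab: "a = (k, q)" "b = (k', q')" by (metis prod.exhaust)
    have "g a 0 = k" "g b 0 = k'" using a b c by (auto simp: ab g_def)
    then have k: "k = k'" using e by simp
    have "inj (c k)" using a c(1) by (auto simp: ab dest: permutes_inj)
    then have "suc_perm q (Suc i) = suc_perm q' (Suc i)" for i
      using fun_cong[OF e, of "Suc i"] by (auto simp: k ab g_def dest: injD)
    then show "a = b" by (simp add: ab k fun_eq_iff)
  qed
  have sub: "g ` ?A \<subseteq> ?B"
    using c(1) by (auto simp: g_def intro!: permutes_compose suc_perm_permutes)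
  \<comment> \<open>Surjectivity of g is obtained by counting: (n + 1) * n! = (n + 1)!.\<close>
  have "card (g ` ?A) = fact (Suc n)"
    by (simp add: card_image[OF inj] card_cartesian_product card_permutations[of _ n])
  also have "\<dots> = card ?B" by (simp add: card_permutations[of _ "Suc n"])
  finally have "g ` ?A = ?B" by (intro card_subset_eq finite_permutations sub) auto
  then have "sum h ?B = (\<Sum>a\<in>?A. h (g a))"
    using sum.reindex[OF inj, of h] by (simp add: comp_def)
  also have "\<dots> = (\<Sum>k<Suc n. \<Sum>q | q permutes {..<n}. h (c k \<circ> suc_perm q))"
    by (simp add: sum.cartesian_product g_def case_prod_unfold)
  finally show ?thesis .
qed

text \<open>The coface map: precomposition with \<open>skip j\<close> omits the argument at position
  j and keeps the order of the others.\<close>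

definition skip :: "nat \<Rightarrow> nat \<Rightarrow> nat"
  where "skip j i = (if i < j then i else Suc i)"

text \<open>The cycle 0 -> j -> j - 1 -> ... -> 1 -> 0. Composing an argument function x with it
  lists x j first and then the others in order; its sign is the source of the sign (-1)^j in the
  differential.\<close>

definition to_front :: "nat \<Rightarrow> nat \<Rightarrow> nat"
  where "to_front j = case_nat j (skip j)"

lemma to_front_simps [simp]: "to_front j 0 = j" "to_front j (Suc i) = skip j i"
  by (simp_all add: to_front_def)

lemma to_front_0: "to_front 0 = id"
  by (auto simp: to_front_def skip_def fun_eq_iff split: nat.split)

text \<open>One more adjacent transposition per step, so that both membership in the symmetric group
  and the sign follow by induction on j.\<close>

lemma to_front_Suc: "to_front (Suc j) = transpose j (Suc j) \<circ> to_front j"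
  by (auto simp: to_front_def skip_def fun_eq_iff transpose_def split: nat.split)

lemma to_front_permutes: "j < n \<Longrightarrow> to_front j permutes {..<n}"
  by (induction j) (auto simp: to_front_0 to_front_Suc permutes_id simp del: to_front_simps intro!: permutes_compose permutes_swap_id)

lemma sign_to_front: "sign (to_front j) = (-1) ^ j"
proof (induction j)
  case 0
  show ?case by (simp only: to_front_0 sign_id power_0)
next
  case (Suc j)
  have "permutation (to_front j)"
    using to_front_permutes[of j "Suc j"] by (auto intro: permutes_imp_permutation)
  then show ?case
    by (simp only: to_front_Suc sign_compose permutation_swap_id sign_swap_id Suc) simp
qed

section \<open>Omitted list entries as precomposition with coface maps\<close>

lemma nths_upt_skip:
  "j < Suc n \<Longrightarrow> nths [0..<Suc n] (- {j}) = map (skip j) [0..<n]"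
proof (induction n)
  case 0
  then show ?case by simp
next
  case (Suc n)
  show ?case
  proof (cases "j = Suc n")
    case True
    have "nths [0..<Suc n] (- {j}) = [0..<Suc n]"
      by (rule nths_all) (auto simp: True)
    then show ?thesis
      by (subst upt_Suc) (auto simp: nths_append nths_Cons True skip_def intro!: map_idI[symmetric])
  next
    case False
    then have "j < Suc n" using Suc by simp
    then show ?thesis
      using Suc.IH by (subst upt_Suc) (auto simp: nths_append skip_def simp del: upt_Suc, simp add: skip_def)
  qed
qed

text \<open>Since i < j, the omission of j leaves i at its position; hence \<open>skip i\<close> is
  applied to the index first and \<open>skip j\<close> afterwards.\<close>

lemma nths_upt_skip2:
  "i < j \<Longrightarrow> j < Suc (Suc n) \<Longrightarrow>
    nths [0..<Suc (Suc n)] (- {i, j}) = map (\<lambda>k. skip j (skip i k)) [0..<n]"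
proof (induction n)
  case 0
  then have "i = 0" "j = 1" by auto
  then show ?case by (simp add: nths_Cons)
next
  case (Suc n)
  show ?case
  proof (cases "j = Suc (Suc n)")
    case True
    have "nths [0..<Suc (Suc n)] (- {i, j}) = nths [0..<Suc (Suc n)] (- {i})"
      unfolding nths_def by (auto simp: True set_zip intro!: arg_cong[where f = "map fst"] filter_cong)
    then have "nths [0..<Suc (Suc (Suc n))] (- {i, j}) = nths [0..<Suc (Suc n)] (- {i})"
      by (subst upt_Suc) (simp add: nths_append True del: upt_Suc)
    also have "\<dots> = map (skip i) [0..<Suc n]" using Suc by (intro nths_upt_skip) simp
    also have "\<dots> = map (\<lambda>k. skip j (skip i k)) [0..<Suc n]"
      by (rule map_cong) (auto simp: skip_def True)
    finally show ?thesis .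
  next
    case False
    then have j: "j < Suc (Suc n)" using Suc by simp
    then show ?thesis
      using Suc.IH[OF Suc.prems(1) j] Suc.prems(1)
      by (subst upt_Suc) (auto simp: nths_append skip_def simp del: upt_Suc, simp add: skip_def)
  qed
qed

lemma nths_map_skip:
  "j < Suc n \<Longrightarrow> nths (map x [0..<Suc n]) (- {j}) = map (x \<circ> skip j) [0..<n]"
  by (simp add: nths_map nths_upt_skip del: upt_Suc)

lemma nths_map_skip2:
  "i < j \<Longrightarrow> j < Suc (Suc n) \<Longrightarrow>
    nths (map x [0..<Suc (Suc n)]) (- {i, j}) = map (x \<circ> skip j \<circ> skip i) [0..<n]"
  by (simp add: nths_map nths_upt_skip2 comp_def del: upt_Suc)

section \<open>Alternation\<close>

text \<open>
  Arguments are given as functions on \<open>nat\<close> of which only the values below the degree matter, so that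
  permuting arguments is composition.
\<close>

definition alternation ::
  "('k::field \<Rightarrow> 'v::ab_group_add \<Rightarrow> 'v) \<Rightarrow> nat \<Rightarrow> ((nat \<Rightarrow> 'a) \<Rightarrow> 'v) \<Rightarrow> (nat \<Rightarrow> 'a) \<Rightarrow> 'v"
  where "alternation scale n F x =
    (\<Sum>\<tau> | \<tau> permutes {..<n}. scale (of_int (sign \<tau>)) (F (x \<circ> \<tau>)))"

context vector_space
begin

lemma alternation_add:
  "alternation scale n (\<lambda>y. F y + G y) x = alternation scale n F x + alternation scale n G x"
  by (simp add: alternation_def scale_right_distrib sum.distrib)

lemma alternation_diff:
  "alternation scale n (\<lambda>y. F y - G y) x = alternation scale n F x - alternation scale n G x"
  by (simp add: alternation_def scale_right_diff_distrib sum_subtractf)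

lemma alternation_scale:
  "alternation scale n (\<lambda>y. c *s F y) x = c *s alternation scale n F x"
  by (simp add: alternation_def scale_sum_right mult.commute)

lemma alternation_sum:
  "alternation scale n (\<lambda>y. \<Sum>i\<in>I. F i y) x = (\<Sum>i\<in>I. alternation scale n (F i) x)"
  unfolding alternation_def by (subst sum.swap) (simp add: scale_sum_right)

lemma alternation_zero: "alternation scale n (\<lambda>y. 0) x = 0"
  by (simp add: alternation_def)

text \<open>Reindexing by \<tau> -> \<tau> o \<pi>. It identifies the alternations of integrands
  that differ only by a permutation of their slots.\<close>

lemma alternation_compose:
  assumes "\<pi> permutes {..<n}"
  shows "alternation scale n (\<lambda>y. F (y \<circ> \<pi>)) x = of_int (sign \<pi>) *s alternation scale n F x"
proof -
  have "alternation scale n F x = (\<Sum>\<tau> | \<tau> permutes {..<n}. of_int (sign (\<tau> \<circ> \<pi>)) *s F (x \<circ> (\<tau> \<circ> \<pi>)))"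
    unfolding alternation_def by (rule sum_permutations_compose_right[OF assms])
  also have "\<dots> = (\<Sum>\<tau> | \<tau> permutes {..<n}. of_int (sign \<pi>) *s (of_int (sign \<tau>) *s F (x \<circ> \<tau> \<circ> \<pi>)))"
    using assms by (intro sum.cong) (auto simp: sign_compose_permutes[of "{..<n}"] comp_assoc mult.commute)
  also have "\<dots> = of_int (sign \<pi>) *s alternation scale n (\<lambda>y. F (y \<circ> \<pi>)) x"
    by (simp add: alternation_def scale_sum_right)
  finally show ?thesis
    by (simp flip: of_int_mult)
qed

text \<open>Reindexing by \<tau> -> \<pi> o \<tau>. It is the antisymmetry of the alternation in its
  own arguments.\<close>

lemma alternation_permute:
  assumes "\<pi> permutes {..<n}"
  shows "alternation scale n F (x \<circ> \<pi>) = of_int (sign \<pi>) *s alternation scale n F x"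
proof -
  have "alternation scale n F x = (\<Sum>\<tau> | \<tau> permutes {..<n}. of_int (sign (\<pi> \<circ> \<tau>)) *s F (x \<circ> (\<pi> \<circ> \<tau>)))"
    unfolding alternation_def by (rule setum_permutations_compose_left[OF assms])
  also have "\<dots> = (\<Sum>\<tau> | \<tau> permutes {..<n}. of_int (sign \<pi>) *s (of_int (sign \<tau>) *s F (x \<circ> \<pi> \<circ> \<tau>)))"
    using assms by (intro sum.cong) (auto simp: sign_compose_permutes[of "{..<n}"] comp_assoc mult.commute)
  also have "\<dots> = of_int (sign \<pi>) *s alternation scale n F (x \<circ> \<pi>)"
    by (simp add: alternation_def scale_sum_right)
  finally show ?thesis
    by (simp flip: of_int_mult)
qed

text \<open>Every inner permutation is also one of the n arguments, so reindexing absorbs it and its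
  sign occurs twice. The m! equal terms later cancel a factorial in the normalisation of the wedge
  product.\<close>

lemma alternation_alternation:
  assumes "m \<le> n"
  shows "alternation scale n (alternation scale m F) x = of_nat (fact m) *s alternation scale n F x"
proof -
  have "alternation scale n (alternation scale m F) x =
      (\<Sum>\<rho> | \<rho> permutes {..<m}. of_int (sign \<rho>) *s alternation scale n (\<lambda>y. F (y \<circ> \<rho>)) x)"
    by (subst alternation_def[of scale m, abs_def]) (simp add: alternation_sum alternation_scale)
  also have "\<dots> = (\<Sum>\<rho> | \<rho> permutes {..<m}. alternation scale n F x)"
  proof (rule sum.cong[OF refl])
    fix \<rho> assume "\<rho> \<in> {\<rho>. \<rho> permutes {..<m}}"
    then have "\<rho> permutes {..<n}" using assms by (auto intro: permutes_subset)
    then show "of_int (sign \<rho>) *s alternation scale n (\<lambda>y. F (y \<circ> \<rho>)) x = alternation scale n F x"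
      by (simp add: alternation_compose flip: of_int_mult)
  qed
  also have "\<dots> = of_nat (fact m) *s alternation scale n F x"
    using card_permutations[of "{..<m}" m] by (simp add: sum_constant_scale)
  finally show ?thesis .
qed

text \<open>Laplace expansion along the first slot: permutations are sorted by the argument j that
  they put there, with \<open>to_front j\<close> as coset representative. The right-hand side has
  the shape of the first sum of the differential.\<close>

lemma alternation_expand_first:
  "alternation scale (Suc n) F x =
    (\<Sum>j<Suc n. (-1) ^ j *s alternation scale n (\<lambda>y. F (case_nat (x j) y)) (x \<circ> skip j))"
proof -
  have "alternation scale (Suc n) F x = (\<Sum>j<Suc n. \<Sum>q | q permutes {..<n}.
      of_int (sign (to_front j \<circ> suc_perm q)) *s F (x \<circ> (to_front j \<circ> suc_perm q)))"
    unfolding alternation_def by (rule sum_permutations_Suc) (auto intro: to_front_permutes)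
  also have "\<dots> = (\<Sum>j<Suc n. (-1) ^ j *s alternation scale n (\<lambda>y. F (case_nat (x j) y)) (x \<circ> skip j))"
  proof (rule sum.cong[OF refl])
    fix j assume j: "j \<in> {..<Suc n}"
    have "of_int (sign (to_front j \<circ> suc_perm q)) *s F (x \<circ> (to_front j \<circ> suc_perm q)) =
      (-1) ^ j *s (of_int (sign q) *s F (case_nat (x j) (x \<circ> skip j \<circ> q)))"
      if q: "q permutes {..<n}" for q
    proof -
      have "sign (to_front j \<circ> suc_perm q) = (-1) ^ j * sign q"
        using j q sign_compose_permutes[of "{..<Suc n}" "to_front j" "suc_perm q"]
        by (simp add: to_front_permutes suc_perm_permutes sign_to_front sign_suc_perm del: lessThan_Suc)
      moreover have "x \<circ> (to_front j \<circ> suc_perm q) = case_nat (x j) (x \<circ> skip j \<circ> q)"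
        by (auto simp: fun_eq_iff split: nat.split)
      ultimately show ?thesis by simp
    qed
    then show "(\<Sum>q | q permutes {..<n}.
        of_int (sign (to_front j \<circ> suc_perm q)) *s F (x \<circ> (to_front j \<circ> suc_perm q))) =
      (-1) ^ j *s alternation scale n (\<lambda>y. F (case_nat (x j) y)) (x \<circ> skip j)"
      by (simp add: alternation_def scale_sum_right)
  qed
  finally show ?thesis .
qed

text \<open>Laplace expansion along two slots. Each pair of positions occurs in both orders, and by
  antisymmetry of F both occurrences contribute the same, whence the 2. The minus sign comes in one
  order from exchanging the two arguments, in the other from the later position being counted one
  lower once the earlier one is omitted.\<close>

lemma alternation_expand_first_two:
  assumes anti: "\<And>a b y. F (case_nat a (case_nat b y)) = - F (case_nat b (case_nat a y))"
  shows "2 *s (\<Sum>j<Suc (Suc n). \<Sum>i<j. (-1) ^ (i + j) *s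
      alternation scale n (\<lambda>y. F (case_nat (x i) (case_nat (x j) y))) (x \<circ> skip j \<circ> skip i)) =
    - alternation scale (Suc (Suc n)) F x"
proof -
  define t where "t j i = (-1) ^ (i + j) *s
      alternation scale n (\<lambda>y. F (case_nat (x i) (case_nat (x j) y))) (x \<circ> skip j \<circ> skip i)" for j i
  have neg: "alternation scale n (\<lambda>y. F (case_nat a (case_nat b y))) z =
      - alternation scale n (\<lambda>y. F (case_nat b (case_nat a y))) z" for a b z
    using alternation_scale[of n "-1" "\<lambda>y. F (case_nat b (case_nat a y))" z]
    by (subst anti) simp
  \<comment> \<open>The term with x j in the first slot and entry i of the remaining arguments in
    the second; that entry stands at position \<open>skip j i\<close> of x.\<close>
  define u where "u j i = (-1) ^ (i + j) *s alternation scale n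
      (\<lambda>y. F (case_nat (x j) (case_nat (x (skip j i)) y))) (x \<circ> skip j \<circ> skip i)" for j i
  have lo: "u j i = - t j i" if "i < j" for i j
    using that neg[of "x i" "x j"] by (simp add: u_def t_def skip_def)
  have hi: "u j i = - t (Suc i) j" if "j \<le> i" for i j
  proof -
    \<comment> \<open>The cosimplicial identity: the same two positions, omitted in the other
      order.\<close>
    have "skip j \<circ> skip i = skip (Suc i) \<circ> skip j"
      using that by (auto simp: skip_def fun_eq_iff)
    then show ?thesis
      using that by (simp add: u_def t_def skip_def comp_assoc add.commute)
  qed
  have "alternation scale (Suc (Suc n)) F x = (\<Sum>j<Suc (Suc n). \<Sum>i<Suc n. u j i)"
    by (subst alternation_expand_first, subst alternation_expand_first)
      (simp add: u_def scale_sum_right power_add mult.commute comp_assoc del: sum.lessThan_Suc)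
  also have "\<dots> = (\<Sum>j<Suc (Suc n). (\<Sum>i<j. u j i) + (\<Sum>i=j..<Suc n. u j i))"
  proof (rule sum.cong[OF refl])
    fix j assume "j \<in> {..<Suc (Suc n)}"
    then have "sum (u j) {..<Suc n} = sum (u j) ({..<j} \<union> {j..<Suc n})"
      by (intro arg_cong[where f = "sum (u j)"]) auto
    also have "\<dots> = sum (u j) {..<j} + sum (u j) {j..<Suc n}"
      by (rule sum.union_disjoint) auto
    finally show "(\<Sum>i<Suc n. u j i) = (\<Sum>i<j. u j i) + (\<Sum>i=j..<Suc n. u j i)" .
  qed
  also have "\<dots> = - (\<Sum>j<Suc (Suc n). \<Sum>i<j. t j i) - (\<Sum>j<Suc (Suc n). \<Sum>i=j..<Suc n. t (Suc i) j)"
    by (simp add: sum.distrib sum_subtractf lo hi sum_negf del: sum.lessThan_Suc sum.op_ivl_Suc)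
  \<comment> \<open>A pair j \<le> i corresponds to the strictly ordered pair j < Suc i.\<close>
  also have "(\<Sum>j<Suc (Suc n). \<Sum>i=j..<Suc n. t (Suc i) j) = (\<Sum>j<Suc (Suc n). \<Sum>i<j. t j i)"
    unfolding sum.Sigma[OF finite_lessThan ballI[OF finite_atLeastLessThan]]
      sum.Sigma[OF finite_lessThan ballI[OF finite_lessThan]]
    by (rule sum.reindex_bij_witness[of _ "\<lambda>(j, i). (i, j - 1)" "\<lambda>(j, i). (Suc i, j)"]) auto
  finally show ?thesis
    by (simp add: t_def scale_left_distrib[of 1 1, simplified] del: sum.lessThan_Suc)
qed

text \<open>Dual to the Laplace expansion: permutations are sorted by the slot k that receives x 0.
  The permutation \<pi> k carries slot 0 to slot k, and G changes under it by its sign only, so all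
  n + 1 slots contribute equally.\<close>

lemma alternation_fix_first:
  assumes \<pi>: "\<And>k. k < Suc n \<Longrightarrow> \<pi> k permutes {..<Suc n}" "\<And>k. k < Suc n \<Longrightarrow> \<pi> k 0 = k"
    and G: "\<And>k z. k < Suc n \<Longrightarrow> G (z \<circ> \<pi> k) = of_int (sign (\<pi> k)) *s G z"
  shows "alternation scale (Suc n) G x =
    of_nat (Suc n) *s alternation scale n (\<lambda>y. G (case_nat (x 0) y)) (x \<circ> Suc)"
proof -
  \<comment> \<open>Passing to inverses turns the left cosets of \<open>sum_permutations_Suc\<close>
    into right cosets, as composition of G with \<pi> k acts on the right.\<close>
  have "alternation scale (Suc n) G x =
      (\<Sum>\<tau> | \<tau> permutes {..<Suc n}. of_int (sign (inv \<tau>)) *s G (x \<circ> inv \<tau>))"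
    unfolding alternation_def by (rule sum_permutations_inverse)
  also have "\<dots> = (\<Sum>k<Suc n. \<Sum>q | q permutes {..<n}.
      of_int (sign (inv (\<pi> k \<circ> suc_perm q))) *s G (x \<circ> inv (\<pi> k \<circ> suc_perm q)))"
    by (rule sum_permutations_Suc) (auto intro: \<pi>)
  also have "\<dots> = (\<Sum>k<Suc n. \<Sum>q | q permutes {..<n}. of_int (sign (inv q)) *s G (x \<circ> suc_perm (inv q)))"
  proof (intro sum.cong refl)
    fix k q assume k: "k \<in> {..<Suc n}" and "q \<in> {q. q permutes {..<n}}"
    then have q: "q permutes {..<n}" and p: "\<pi> k permutes {..<Suc n}" using \<pi>(1) by auto
    note s = suc_perm_permutes[OF q]
    have e: "inv (\<pi> k \<circ> suc_perm q) = suc_perm (inv q) \<circ> inv (\<pi> k)"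
      using p s q by (simp add: o_inv_distrib permutes_bij inv_suc_perm)
    have sgn: "sign (suc_perm (inv q) \<circ> inv (\<pi> k)) = sign (inv q) * sign (\<pi> k)"
      using p q by (simp add: sign_compose_permutes[of "{..<Suc n}"] suc_perm_permutes permutes_inv
          sign_suc_perm[of _ n] sign_inverse permutes_imp_permutation[of "{..<Suc n}"] del: lessThan_Suc)
    have "G (x \<circ> suc_perm (inv q)) = of_int (sign (\<pi> k)) *s G (x \<circ> (suc_perm (inv q) \<circ> inv (\<pi> k)))"
      using G[of k "x \<circ> (suc_perm (inv q) \<circ> inv (\<pi> k))"] k
      by (simp add: comp_assoc permutes_inv_o[OF p])
    then show "of_int (sign (inv (\<pi> k \<circ> suc_perm q))) *s G (x \<circ> inv (\<pi> k \<circ> suc_perm q)) =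
        of_int (sign (inv q)) *s G (x \<circ> suc_perm (inv q))"
      by (simp add: e sgn)
  qed
  also have "\<dots> = of_nat (Suc n) *s (\<Sum>q | q permutes {..<n}. of_int (sign (inv q)) *s G (x \<circ> suc_perm (inv q)))"
    by (simp add: sum_constant_scale del: sum.lessThan_Suc)
  also have "(\<Sum>q | q permutes {..<n}. of_int (sign (inv q)) *s G (x \<circ> suc_perm (inv q))) =
      (\<Sum>q | q permutes {..<n}. of_int (sign q) *s G (x \<circ> suc_perm q))"
    by (rule sum_permutations_inverse[symmetric])
  finally have "alternation scale (Suc n) G x =
      of_nat (Suc n) *s (\<Sum>q | q permutes {..<n}. of_int (sign q) *s G (x \<circ> suc_perm q))" .
  moreover have "x \<circ> suc_perm q = case_nat (x 0) (x \<circ> Suc \<circ> q)" for q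
    by (auto simp: fun_eq_iff split: nat.split)
  ultimately show ?thesis by (simp only: alternation_def[of scale n])
qed

end

section \<open>Powers of the curvature\<close>

text \<open>Scaling on representatives. Polynomials form a vector space, so the alternation lemmas
  apply to them, whereas the type of sets of polynomials is no group.\<close>

definition poly_scale :: "'k::comm_semiring_1 \<Rightarrow> ('n multiset \<Rightarrow>\<^sub>0 'k) \<Rightarrow> ('n multiset \<Rightarrow>\<^sub>0 'k)"
  where "poly_scale c P = Poly_Mapping.single {#} c * P"

lemma vector_space_poly_scale: "vector_space (poly_scale :: 'k::field \<Rightarrow> ('n multiset \<Rightarrow>\<^sub>0 'k) \<Rightarrow> _)"
  by standard (simp_all add: poly_scale_def distrib_left distrib_right single_add mult_single flip: mult.assoc)

lemma poly_scale_single: "poly_scale c (Poly_Mapping.single M b) = Poly_Mapping.single M (c * b)"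
  by (simp add: poly_scale_def mult_single)

lemma poly_scale_mult_left: "poly_scale c P * Q = poly_scale c (P * Q)"
  by (simp add: poly_scale_def mult.assoc)

lemma sym_scale_coset': "sym_scale s c (P +o sym_ideal s) = poly_scale c P +o sym_ideal s"
  by (simp add: poly_scale_def sym_scale_coset)

lemma sym_coset_sum:
  assumes "finite A" "A \<noteq> {}"
  shows "(\<Sum>a\<in>A. P a +o sym_ideal s) = (\<Sum>a\<in>A. P a) +o sym_ideal s"
  using assms by (induction rule: finite_ne_induct) (simp_all add: sym_coset_add)

text \<open>Evaluates the lift termwise on a combination of monomials. The lift is additive only on
  the symmetric power, so membership has to be carried through the same induction.\<close>

lemma sym_lift_sum_single:
  assumes f: "f \<in> symmetric_maps scale_n scale_v p"
    and N: "vector_space scale_n" and V: "vector_space scale_v"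
    and A: "finite A" "\<And>a. a \<in> A \<Longrightarrow> length (l a) = p"
  shows "(\<Sum>a\<in>A. poly_scale (c a) (Poly_Mapping.single (mset (l a)) 1)) +o sym_ideal scale_n \<in> sym_power scale_n p
    \<and> sym_lift scale_n scale_v p f
        ((\<Sum>a\<in>A. poly_scale (c a) (Poly_Mapping.single (mset (l a)) 1)) +o sym_ideal scale_n) =
      (\<Sum>a\<in>A. scale_v (c a) (f (l a)))"
proof -
  interpret V: vector_space scale_v by (rule V)
  let ?I = "sym_ideal scale_n" and ?\<phi> = "sym_lift scale_n scale_v p f"
  have \<phi>: "is_sym_lift scale_n scale_v p f ?\<phi>" by (rule is_sym_lift_sym_lift[OF f N V])
  have mem: "P +o ?I \<in> sym_power scale_n p" if "\<forall>M\<in>Poly_Mapping.keys P. size M = p" for P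
    using that unfolding sym_power_def by blast
  have single_mem: "Poly_Mapping.single (mset ys) b +o ?I \<in> sym_power scale_n p" if "length ys = p" for ys b
    using that by (intro mem) (auto split: if_splits)
  have single: "?\<phi> (Poly_Mapping.single (mset ys) b +o ?I) = scale_v b (f ys)" if "length ys = p" for ys b
  proof -
    have "Poly_Mapping.single (mset ys) b +o ?I = sym_scale scale_n b (sym_product scale_n ys)"
      by (simp add: sym_product_coset sym_scale_coset' poly_scale_single)
    then show ?thesis
      using \<phi> single_mem[OF that, of 1] that unfolding is_sym_lift_def by (metis sym_product_coset)
  qed
  have zero_mem: "0 +o ?I \<in> sym_power scale_n p" by (intro mem) simp
  have zero: "?\<phi> (0 +o ?I) = 0"
  proof -
    have "sym_scale scale_n 0 (0 +o ?I) = 0 +o ?I" by (simp add: sym_scale_coset' poly_scale_def del: set_zero_plus)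
    then show ?thesis using \<phi> zero_mem unfolding is_sym_lift_def by (metis V.scale_zero_left)
  qed
  have add: "?\<phi> ((P + Q) +o ?I) = ?\<phi> (P +o ?I) + ?\<phi> (Q +o ?I) \<and> (P + Q) +o ?I \<in> sym_power scale_n p"
    if "P +o ?I \<in> sym_power scale_n p" "Q +o ?I \<in> sym_power scale_n p" for P Q
  proof
    show "?\<phi> ((P + Q) +o ?I) = ?\<phi> (P +o ?I) + ?\<phi> (Q +o ?I)"
      using \<phi> that unfolding is_sym_lift_def sym_coset_add[symmetric] by blast
    obtain P' Q' where P': "P +o ?I = P' +o ?I" "\<forall>M \<in> Poly_Mapping.keys P'. size M = p"
      and Q': "Q +o ?I = Q' +o ?I" "\<forall>M \<in> Poly_Mapping.keys Q'. size M = p"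
      using \<open>P +o ?I \<in> _\<close> \<open>Q +o ?I \<in> _\<close> unfolding sym_power_def by blast
    have "(P + Q) +o ?I = (P' + Q') +o ?I" by (metis P'(1) Q'(1) sym_coset_add)
    moreover have "(P' + Q') +o ?I \<in> sym_power scale_n p"
      by (rule mem) (use P'(2) Q'(2) keys_add[of P' Q'] in blast)
    ultimately show "(P + Q) +o ?I \<in> sym_power scale_n p" by (simp only:)
  qed
  show ?thesis
    using A
  proof (induction rule: finite_induct)
    case empty
    show ?case by (simp only: sum.empty zero zero_mem simp_thms)
  next
    case (insert a A)
    then show ?case
      using add[OF single_mem[of "l a" "c a"], of "\<Sum>a\<in>A. poly_scale (c a) (Poly_Mapping.single (mset (l a)) 1)"]
      by (simp add: poly_scale_single single)
  qed
qed

section \<open>The curvature power as an alternation of monomials\<close>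

definition pair_values :: "('a \<Rightarrow> 'a \<Rightarrow> 'b) \<Rightarrow> nat \<Rightarrow> (nat \<Rightarrow> 'a) \<Rightarrow> 'b list"
  where "pair_values R p x = map (\<lambda>i. R (x (2 * i)) (x (2 * i + 1))) [0..<p]"

lemma length_pair_values [simp]: "length (pair_values R p x) = p"
  by (simp add: pair_values_def)

lemma nth_pair_values [simp]: "i < p \<Longrightarrow> pair_values R p x ! i = R (x (2 * i)) (x (2 * i + 1))"
  by (simp add: pair_values_def)

lemma permute_list_map_upt:
  assumes "\<tau> permutes {..<n}"
  shows "permute_list \<tau> (map x [0..<n]) = map (x \<circ> \<tau>) [0..<n]"
  using permutes_in_image[OF assms] by (simp add: permute_list_def)

text \<open>P and Q receive the whole argument function although they represent \<alpha> on the
  initial and \<beta> on the final segment; this makes the wedge product one alternation of a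
  product of polynomials.\<close>

lemma wedge_sym_cosets:
  assumes \<alpha>: "\<And>y. \<alpha> (map y [0..<n]) = P y +o sym_ideal s"
    and \<beta>: "\<And>y. \<beta> (map (\<lambda>i. y (n + i)) [0..<m]) = Q y +o sym_ideal s"
  shows "wedge (sym_scale s) (sym_mult s) n m \<alpha> \<beta> (map x [0..<n + m]) =
    poly_scale (1 / (fact n * fact m)) (alternation poly_scale (n + m) (\<lambda>y. P y * Q y) x) +o sym_ideal s"
proof -
  let ?S = "{\<tau>. \<tau> permutes {..<n + m}}"
  have ne: "?S \<noteq> {}" using permutes_id by blast
  have "sym_scale s (of_int (sign \<tau>)) (sym_mult s (\<alpha> (take n (permute_list \<tau> (map x [0..<n + m]))))
      (\<beta> (drop n (permute_list \<tau> (map x [0..<n + m]))))) =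
    poly_scale (of_int (sign \<tau>)) (P (x \<circ> \<tau>) * Q (x \<circ> \<tau>)) +o sym_ideal s" if "\<tau> \<in> ?S" for \<tau>
  proof -
    have "drop n (map (x \<circ> \<tau>) [0..<n + m]) = map (\<lambda>i. (x \<circ> \<tau>) (n + i)) [0..<m]"
      by (rule nth_equalityI) auto
    moreover have "take n (map (x \<circ> \<tau>) [0..<n + m]) = map (x \<circ> \<tau>) [0..<n]"
      by (simp add: take_map)
    ultimately show ?thesis
      using that by (simp only: permute_list_map_upt mem_Collect_eq \<alpha> \<beta> sym_mult_coset sym_scale_coset')
  qed
  then show ?thesis
    unfolding wedge_def alternation_def
    by (simp add: sym_coset_sum[OF finite_permutations[OF finite_lessThan] ne] sym_scale_coset')
qed

text \<open>In the induction step the new factor depends only on the arguments 2p and 2p + 1, which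
  the inner permutations fix. It can be moved inside the inner alternation, which the outer one then
  absorbs with the factor (2p)!.\<close>

lemma curvature_power_eq:
  fixes scale_n :: "'k::field_char_0 \<Rightarrow> 'n::ab_group_add \<Rightarrow> 'n"
    and \<sigma> :: "'g \<Rightarrow> 'e::ab_group_add"
  shows "curvature_power scale_n bracket_e bracket_g \<iota> \<sigma> p (map x [0..<2 * p]) =
    poly_scale (1 / 2 ^ p) (alternation poly_scale (2 * p) (\<lambda>y. Poly_Mapping.single
      (mset (pair_values (curvature bracket_e bracket_g \<iota> \<sigma>) p y)) 1) x) +o sym_ideal scale_n"
proof (induction p arbitrary: x)
  case 0
  have "alternation poly_scale 0 F x = (F x :: 'n multiset \<Rightarrow>\<^sub>0 'k)" for F
    by (simp add: alternation_def poly_scale_def)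
  then show ?case
    by (simp only: curvature_power.simps mult_0_right sym_one_def) (simp add: pair_values_def poly_scale_def)
next
  case (Suc p)
  interpret P: vector_space "poly_scale :: 'k \<Rightarrow> ('n multiset \<Rightarrow>\<^sub>0 'k) \<Rightarrow> _" by (rule vector_space_poly_scale)
  let ?R = "curvature bracket_e bracket_g \<iota> \<sigma>" and ?I = "sym_ideal scale_n"
  define Q :: "nat \<Rightarrow> (nat \<Rightarrow> 'g) \<Rightarrow> 'n multiset \<Rightarrow>\<^sub>0 'k"
    where "Q p y = Poly_Mapping.single (mset (pair_values ?R p y)) 1" for p y
  define S :: "(nat \<Rightarrow> 'g) \<Rightarrow> 'n multiset \<Rightarrow>\<^sub>0 'k"
    where "S y = Poly_Mapping.single {#?R (y (2 * p)) (y (2 * p + 1))#} 1" for y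
  have Q_Suc: "Q p z * S z = Q (Suc p) z" for z
    by (simp add: Q_def S_def pair_values_def mult_single)
  have "alternation poly_scale (2 * p) (Q p) y * S y = alternation poly_scale (2 * p) (Q (Suc p)) y" for y
  proof -
    have "Q p (y \<circ> \<tau>) * S y = Q (Suc p) (y \<circ> \<tau>)" if "\<tau> permutes {..<2 * p}" for \<tau>
    proof -
      have "S (y \<circ> \<tau>) = S y" by (simp add: S_def permutes_not_in[OF that])
      then show ?thesis by (metis Q_Suc)
    qed
    then show ?thesis by (simp add: alternation_def sum_distrib_right poly_scale_mult_left)
  qed
  then have alt: "poly_scale c (alternation poly_scale (2 * p) (Q p) y) * S y =
      poly_scale c (alternation poly_scale (2 * p) (Q (Suc p)) y)" for c y
    by (simp add: poly_scale_mult_left)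
  have "curvature_power scale_n bracket_e bracket_g \<iota> \<sigma> (Suc p) (map x [0..<2 * p + 2]) =
    poly_scale (1 / (fact (2 * p) * fact 2)) (alternation poly_scale (2 * p + 2)
      (\<lambda>y. poly_scale (1 / 2 ^ p) (alternation poly_scale (2 * p) (Q p) y) * S y) x) +o ?I"
    unfolding curvature_power.simps Q_def
    by (rule wedge_sym_cosets, rule Suc.IH) (simp add: S_def sym_incl_def)
  also have "\<dots> = poly_scale (1 / 2 ^ Suc p) (alternation poly_scale (2 * p + 2) (Q (Suc p)) x) +o ?I"
    unfolding alt P.alternation_scale P.alternation_alternation[OF le_add1] P.scale_scale
    by (simp add: field_simps)
  finally show ?case by (simp add: Q_def[abs_def])
qed

lemma delta_cochain_eq:
  assumes f: "f \<in> symmetric_maps scale_n scale_v p"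
    and N: "vector_space scale_n" and V: "vector_space scale_v"
  shows "delta_cochain scale_n bracket_e bracket_g \<iota> scale_v \<sigma> p f (map x [0..<2 * p]) =
    scale_v (1 / 2 ^ p) (alternation scale_v (2 * p)
      (\<lambda>y. f (pair_values (curvature bracket_e bracket_g \<iota> \<sigma>) p y)) x)"
proof -
  let ?c = "\<lambda>\<tau>. of_int (sign \<tau>)"
    and ?l = "\<lambda>\<tau>. pair_values (curvature bracket_e bracket_g \<iota> \<sigma>) p (x \<circ> \<tau>)"
    and ?S = "{\<tau>. \<tau> permutes {..<2 * p}}"
  let ?P = "\<Sum>\<tau>\<in>?S. poly_scale (?c \<tau>) (Poly_Mapping.single (mset (?l \<tau>)) 1)"
  have *: "?P +o sym_ideal scale_n \<in> sym_power scale_n p \<and>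
      sym_lift scale_n scale_v p f (?P +o sym_ideal scale_n) = (\<Sum>\<tau>\<in>?S. scale_v (?c \<tau>) (f (?l \<tau>)))"
    by (rule sym_lift_sum_single[OF f N V]) (auto intro: finite_permutations)
  have lift: "sym_lift scale_n scale_v p f (sym_scale scale_n c A) = scale_v c (sym_lift scale_n scale_v p f A)"
    if "A \<in> sym_power scale_n p" for c A
    using is_sym_lift_sym_lift[OF f N V] that unfolding is_sym_lift_def by blast
  have "delta_cochain scale_n bracket_e bracket_g \<iota> scale_v \<sigma> p f (map x [0..<2 * p]) =
      sym_lift scale_n scale_v p f (sym_scale scale_n (1 / 2 ^ p) (?P +o sym_ideal scale_n))"
    unfolding delta_cochain_def curvature_power_eq sym_scale_coset' by (simp add: alternation_def)
  then show ?thesis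
    by (simp only: lift * alternation_def)
qed

section \<open>Alternating cochains and their differential\<close>

lemma linear_iff_add_scale:
  assumes "vector_space s1" "vector_space s2"
  shows "Vector_Spaces.linear s1 s2 h \<longleftrightarrow> (\<forall>x y. h (x + y) = h x + h y) \<and> (\<forall>c x. h (s1 c x) = s2 c (h x))"
  using assms by (simp add: Vector_Spaces.linear_iff)

lemma linear_alternation_eq:
  assumes "Vector_Spaces.linear s1 s2 h"
  shows "h (alternation s1 n F x) = alternation s2 n (\<lambda>y. h (F y)) x"
proof -
  interpret Vector_Spaces.linear s1 s2 h by (rule assms)
  show ?thesis by (simp add: alternation_def sum scale)
qed

context vector_space
begin

lemma alternation_eq_0:
  assumes "(2 :: 'a) \<noteq> 0" and "i < j" "j < n" "x i = x j"
  shows "alternation scale n F x = 0"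
proof -
  have "x \<circ> transpose i j = x" using assms by (auto simp: fun_eq_iff transpose_def)
  then have "alternation scale n F x = - alternation scale n F x"
    using alternation_permute[of "transpose i j" n F x] assms
    by (simp add: permutes_swap_id sign_swap_id)
  then have "2 *s alternation scale n F x = 0"
    by (simp add: scale_left_distrib[of 1 1, simplified] eq_neg_iff_add_eq_0)
  then show ?thesis using assms by simp
qed

lemma linear_alternation:
  assumes F: "\<And>z k. k < n \<Longrightarrow> Vector_Spaces.linear s1 scale (\<lambda>a. F (z(k := a)))" and k: "k < n"
  shows "Vector_Spaces.linear s1 scale (\<lambda>a. alternation scale n F (x(k := a)))"
proof -
  have s1: "vector_space s1" using F[OF k] by (simp add: Vector_Spaces.linear_iff)
  note lin = linear_iff_add_scale[OF s1 vector_space_axioms]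
  \<comment> \<open>Changing argument k before permuting by \<tau> changes slot
    \<open>inv \<tau> k\<close> afterwards.\<close>
  have upd: "x(k := a) \<circ> \<tau> = (x \<circ> \<tau>)(inv \<tau> k := a)" if "\<tau> permutes {..<n}" for a \<tau>
    using permutes_inverses[OF that] by (auto simp: fun_eq_iff)
  have inv: "inv \<tau> k < n" if "\<tau> permutes {..<n}" for \<tau>
    using permutes_in_image[OF permutes_inv[OF that], of k] k by simp
  have "F (x(k := a + b) \<circ> \<tau>) = F (x(k := a) \<circ> \<tau>) + F (x(k := b) \<circ> \<tau>)"
    "F (x(k := s1 c a) \<circ> \<tau>) = c *s F (x(k := a) \<circ> \<tau>)" if "\<tau> permutes {..<n}" for a b c \<tau>
    using F[OF inv[OF that]] unfolding upd[OF that] lin by blast+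
  then show ?thesis
    unfolding lin alternation_def
    by (simp add: scale_right_distrib sum.distrib scale_sum_right mult.commute)
qed

end

lemma alternating_mapsI:
  assumes H: "\<And>x. \<omega> (map x [0..<n]) = H x"
    and len: "\<And>xs. length xs \<noteq> n \<Longrightarrow> \<omega> xs = 0"
    and lin: "\<And>x k. k < n \<Longrightarrow> Vector_Spaces.linear s1 s2 (\<lambda>a. H (x(k := a)))"
    and alt: "\<And>x i j. i < j \<Longrightarrow> j < n \<Longrightarrow> x i = x j \<Longrightarrow> H x = 0"
  shows "\<omega> \<in> alternating_maps s1 s2 n"
  unfolding alternating_maps_def multilinear_maps_def
proof (intro CollectI conjI allI impI; (elim conjE)?)
  fix xs :: "'a list" and i assume xs: "length xs = n" "i < n"
  have "xs[i := a] = map (((!) xs)(i := a)) [0..<n]" for a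
    using xs by (intro nth_equalityI) (auto simp: nth_list_update)
  then show "Vector_Spaces.linear s1 s2 (\<lambda>a. \<omega> (xs[i := a]))"
    using lin[OF xs(2)] by (simp add: H)
next
  fix xs :: "'a list" and i j assume "length xs = n" "i < j" "j < n" "xs ! i = xs ! j"
  then show "\<omega> xs = 0"
    using H[of "(!) xs"] alt[of i j "(!) xs"] map_nth[of xs] by simp
qed (rule len)

text \<open>The differential in terms of argument functions; \<open>case_nat\<close> prepends the
  bracket.\<close>

lemma ce_differential_map_upt:
  assumes H: "\<And>x. \<omega> (map x [0..<n]) = H x"
  shows "ce_differential bracket_g scale_v act \<omega> (map x [0..<Suc n]) =
    (\<Sum>j<Suc n. scale_v ((-1) ^ j) (act (x j) (H (x \<circ> skip j)))) +
    (\<Sum>j<Suc n. \<Sum>i<j. scale_v ((-1) ^ (i + j)) (H (case_nat (bracket_g (x i) (x j)) (x \<circ> skip j \<circ> skip i))))"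
proof -
  have nth: "map x [0..<Suc n] ! j = x j" if "j < Suc n" for j
    using that by (simp del: upt_Suc)
  have "bracket_g (x i) (x j) # nths (map x [0..<Suc n]) (- {i, j}) =
      map (case_nat (bracket_g (x i) (x j)) (x \<circ> skip j \<circ> skip i)) [0..<n]" if ij: "i < j" "j < Suc n" for i j
  proof -
    obtain m where m: "n = Suc m" using ij by (cases n) auto
    show ?thesis
      unfolding m nths_map_skip2[OF ij[unfolded m]] map_upt_Suc[of _ m] by simp
  qed
  then show ?thesis
    unfolding ce_differential_def
    by (simp add: nth nths_map_skip H flip: H del: upt_Suc sum.lessThan_Suc cong: sum.cong_simp)
qed

text \<open>Both sums evaluate \<omega> on lists one shorter than the argument list. This settles
  the lists of wrong length, on which equality of cochains must also hold.\<close>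

lemma ce_differential_eq_0_of_length:
  assumes \<omega>: "\<And>xs. length xs \<noteq> n \<Longrightarrow> \<omega> xs = 0" and xs: "length xs \<noteq> Suc n"
    and V: "vector_space scale_v" and act: "\<And>x. act x 0 = 0"
  shows "ce_differential bracket_g scale_v act \<omega> xs = 0"
proof (cases "length xs")
  case 0
  then show ?thesis by (simp add: ce_differential_def)
next
  case (Suc m)
  interpret vector_space scale_v by (rule V)
  have m: "xs = map ((!) xs) [0..<Suc m]" using map_nth[of xs] Suc by simp
  have 1: "\<omega> (nths xs (- {j})) = 0" if "j < Suc m" for j
    using that Suc xs by (subst m, subst nths_map_skip) (auto intro: \<omega>)
  have 2: "\<omega> (y # nths xs (- {i, j})) = 0" if ij: "i < j" "j < Suc m" for i j y
  proof -
    obtain k where k: "m = Suc k" using ij by (cases m) auto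
    have "length (nths xs (- {i, j})) = k"
      using ij unfolding k by (subst m, unfold k, subst nths_map_skip2) auto
    then show ?thesis using xs Suc k by (auto intro: \<omega>)
  qed
  show ?thesis
    unfolding ce_differential_def Suc by (simp add: 1 2 act)
qed

context lie_algebra
begin

lemma bracket_add_left: "bracket (x + y) z = bracket x z + bracket y z"
  and bracket_add_right: "bracket z (x + y) = bracket z x + bracket z y"
  and bracket_scale_left: "bracket (scale c x) z = scale c (bracket x z)"
  and bracket_scale_right: "bracket z (scale c x) = scale c (bracket z x)"
  using bracket_linear_left[of z] bracket_linear_right[of z] by (simp_all add: Vector_Spaces.linear_iff)

lemma bracket_zero_right: "bracket x 0 = 0"
  using bracket_add_right[of x 0 0] by simp

lemma bracket_anti: "bracket x y = - bracket y x"
proof -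
  have "bracket (x + y) (x + y) = 0" by (rule bracket_self)
  then have "bracket x y + bracket y x = 0"
    by (simp only: bracket_add_left bracket_add_right) (simp add: bracket_self add.commute)
  then show ?thesis by (simp add: eq_neg_iff_add_eq_0)
qed

lemma bracket_diff_right: "bracket z (x - y) = bracket z x - bracket z y"
  using bracket_add_right[of z "x - y" y] by simp

end

text \<open>Exchanges the pair of arguments 0, 1 with the pair 2m, 2m + 1 and hence two curvature
  factors. Two transpositions, or the identity for m = 0, make it even.\<close>

definition block_swap :: "nat \<Rightarrow> nat \<Rightarrow> nat"
  where "block_swap m = transpose 0 (2 * m) \<circ> transpose 1 (2 * m + 1)"

lemma block_swap_permutes: "m < p \<Longrightarrow> block_swap m permutes {..<2 * p}"
  unfolding block_swap_def by (intro permutes_compose permutes_swap_id) auto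

lemma sign_block_swap: "sign (block_swap m) = 1"
  by (simp add: block_swap_def sign_compose permutation_swap_id sign_swap_id)

lemma block_swap_0 [simp]: "block_swap m 0 = 2 * m"
  by (simp add: block_swap_def transpose_def)

lemma block_swap_1 [simp]: "block_swap m (Suc 0) = Suc (2 * m)"
  by (simp add: block_swap_def transpose_def)

lemma pair_values_block_swap:
  assumes "m < p"
  shows "pair_values R p (x \<circ> block_swap m) = permute_list (transpose 0 m) (pair_values R p x)"
proof (rule nth_equalityI)
  fix i assume i: "i < length (pair_values R p (x \<circ> block_swap m))"
  have t: "transpose 0 m permutes {..<p}" using assms by (intro permutes_swap_id) auto
  have "block_swap m (2 * i) = 2 * transpose 0 m i" "block_swap m (2 * i + 1) = 2 * transpose 0 m i + 1"
    by (auto simp: block_swap_def transpose_def) presburger+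
  moreover have "transpose 0 m i < p" using assms i by (simp add: transpose_def)
  ultimately show "pair_values R p (x \<circ> block_swap m) ! i = permute_list (transpose 0 m) (pair_values R p x) ! i"
    using i t by (simp add: permute_list_nth)
qed simp

section \<open>The Bianchi identity and the cocycle property\<close>

locale extension_with_section =
  lie_extension scale_n bracket_n scale_e bracket_e scale_g bracket_g \<iota> q +
  mod: lie_module scale_g bracket_g scale_v act
  for scale_n :: "'k::field_char_0 \<Rightarrow> 'n::ab_group_add \<Rightarrow> 'n" and bracket_n :: "'n \<Rightarrow> 'n \<Rightarrow> 'n"
    and scale_e :: "'k \<Rightarrow> 'e::ab_group_add \<Rightarrow> 'e" and bracket_e :: "'e \<Rightarrow> 'e \<Rightarrow> 'e"
    and scale_g :: "'k \<Rightarrow> 'g::ab_group_add \<Rightarrow> 'g" and bracket_g :: "'g \<Rightarrow> 'g \<Rightarrow> 'g"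
    and \<iota> :: "'n \<Rightarrow> 'e" and q :: "'e \<Rightarrow> 'g"
    and scale_v :: "'k \<Rightarrow> 'v::ab_group_add \<Rightarrow> 'v" and act :: "'g \<Rightarrow> 'v \<Rightarrow> 'v" +
  fixes \<sigma> :: "'g \<Rightarrow> 'e"
  assumes linear_section: "linear_section scale_g scale_e q \<sigma>"
begin

sublocale V: vector_space scale_v
  using mod.act_linear_right by (simp add: Vector_Spaces.linear_iff)

sublocale \<iota>: Vector_Spaces.linear scale_n scale_e \<iota>
  by (rule incl.hom_linear)

sublocale q: Vector_Spaces.linear scale_e scale_g q
  by (rule proj.hom_linear)

sublocale \<sigma>: Vector_Spaces.linear scale_g scale_e \<sigma>
  using linear_section by (simp add: linear_section_def)

section \<open>Curvature and connection of the section\<close>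

abbreviation R :: "'g \<Rightarrow> 'g \<Rightarrow> 'n"
  where "R \<equiv> curvature bracket_e bracket_g \<iota> \<sigma>"

text \<open>The connection that \<sigma> induces on the kernel, which is also the operator in the
  invariance condition. It fails to be a representation by the bracket with the curvature.\<close>

definition conn :: "'g \<Rightarrow> 'n \<Rightarrow> 'n"
  where "conn x y = inv \<iota> (bracket_e (\<sigma> x) (\<iota> y))"

lemma q_section: "q (\<sigma> x) = x"
  using linear_section by (simp add: linear_section_def)

lemma incl_inv: "q z = 0 \<Longrightarrow> \<iota> (inv \<iota> z) = z"
  using exact by (intro f_inv_into_f) auto

lemma q_incl: "q (\<iota> y) = 0"
  using exact by auto

text \<open>Both terms have the same image under q, so their difference lies in the range of
  \<iota>. Identities in the kernel are checked below after applying the injective \<iota>, which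
  removes \<open>inv \<iota>\<close>.\<close>

lemma incl_curvature: "\<iota> (R x y) = bracket_e (\<sigma> x) (\<sigma> y) - \<sigma> (bracket_g x y)"
  unfolding curvature_def by (rule incl_inv) (simp add: q.diff proj.hom_bracket q_section)

lemma incl_conn: "\<iota> (conn x y) = bracket_e (\<sigma> x) (\<iota> y)"
  unfolding conn_def by (rule incl_inv) (simp add: proj.hom_bracket q_incl proj.cod.bracket_zero_right)

lemma curvature_anti: "R x y = - R y x"
proof (rule injD[OF inj_incl])
  show "\<iota> (R x y) = \<iota> (- R y x)"
    using incl.cod.bracket_anti[of "\<sigma> x"] proj.cod.bracket_anti[of x y]
    by (simp add: \<iota>.neg incl_curvature \<sigma>.neg)
qed

lemma linear_curvature_right: "Vector_Spaces.linear scale_g scale_n (R z)"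
proof -
  have "R z (x + y) = R z x + R z y" for x y
    by (rule injD[OF inj_incl])
      (simp add: \<iota>.add incl_curvature \<sigma>.add incl.cod.bracket_add_right proj.cod.bracket_add_right)
  moreover have "R z (scale_g c x) = scale_n c (R z x)" for c x
    by (rule injD[OF inj_incl])
      (simp add: \<iota>.scale incl_curvature \<sigma>.scale incl.cod.bracket_scale_right proj.cod.bracket_scale_right
        incl.cod.scale_right_diff_distrib)
  ultimately show ?thesis
    by (simp add: linear_iff_add_scale incl.dom.vector_space_axioms proj.cod.vector_space_axioms)
qed

lemma linear_curvature_left: "Vector_Spaces.linear scale_g scale_n (\<lambda>x. R x z)"
proof -
  interpret L: Vector_Spaces.linear scale_g scale_n "R z" by (rule linear_curvature_right)
  show ?thesis
    by (subst curvature_anti)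
      (simp add: linear_iff_add_scale incl.dom.vector_space_axioms proj.cod.vector_space_axioms
        L.add L.scale)
qed

text \<open>After applying \<iota>, the triple brackets of lifts vanish by the Jacobi identity in
  the extension, the lifts of triple brackets by the one in the quotient, and the mixed terms
  \<open>bracket_e (\<sigma> x) (\<sigma> (bracket_g y z))\<close> cancel in the cyclic sum.\<close>

lemma bianchi:
  "(conn x (R y z) - R (bracket_g x y) z) + (conn y (R z x) - R (bracket_g y z) x) +
    (conn z (R x y) - R (bracket_g z x) y) = 0"
proof (rule injD[OF inj_incl])
  let ?s = "\<lambda>x y. \<sigma> (bracket_g x y)"
  have flip: "bracket_e (?s x y) (\<sigma> z) = - bracket_e (\<sigma> z) (?s x y)" for x y z
    by (rule incl.cod.bracket_anti)
  have "bracket_g (bracket_g x y) z + bracket_g (bracket_g y z) x + bracket_g (bracket_g z x) y =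
      - (bracket_g x (bracket_g y z) + bracket_g y (bracket_g z x) + bracket_g z (bracket_g x y))"
    using proj.cod.bracket_anti[of "bracket_g x y" z] proj.cod.bracket_anti[of "bracket_g y z" x]
      proj.cod.bracket_anti[of "bracket_g z x" y] by simp
  then have "\<sigma> (bracket_g (bracket_g x y) z + bracket_g (bracket_g y z) x + bracket_g (bracket_g z x) y) = 0"
    by (simp only: proj.cod.jacobi) simp
  then have jac: "?s (bracket_g x y) z + ?s (bracket_g y z) x + ?s (bracket_g z x) y = 0"
    by (simp add: \<sigma>.add)
  show "\<iota> ((conn x (R y z) - R (bracket_g x y) z) + (conn y (R z x) - R (bracket_g y z) x) +
    (conn z (R x y) - R (bracket_g z x) y)) = \<iota> 0"
    using incl.cod.jacobi[of "\<sigma> x" "\<sigma> y" "\<sigma> z"] jac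
    by (simp add: \<iota>.add \<iota>.diff incl_conn incl_curvature incl.cod.bracket_diff_right flip algebra_simps)
qed

section \<open>The cochain of an invariant symmetric map\<close>

context
  fixes p :: nat and f :: "'n list \<Rightarrow> 'v"
  assumes f: "f \<in> invariant_symmetric_maps scale_n bracket_e \<iota> scale_v act \<sigma> p"
begin

lemma symmetric: "f \<in> symmetric_maps scale_n scale_v p"
  using f by (simp add: invariant_symmetric_maps_def)

lemma f_permute: "length ys = p \<Longrightarrow> \<tau> permutes {..<p} \<Longrightarrow> f (permute_list \<tau> ys) = f ys"
  using symmetric by (simp add: symmetric_maps_def)

lemma f_linear: "length ys = p \<Longrightarrow> i < p \<Longrightarrow> Vector_Spaces.linear scale_n scale_v (\<lambda>y. f (ys[i := y]))"
  using symmetric by (simp add: symmetric_maps_def multilinear_maps_def)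

lemma f_invariant: "length ys = p \<Longrightarrow> act x (f ys) = (\<Sum>i<p. f (ys[i := conn x (ys ! i)]))"
  using f by (simp add: invariant_symmetric_maps_def conn_def)

abbreviation G :: "(nat \<Rightarrow> 'g) \<Rightarrow> 'v"
  where "G y \<equiv> f (pair_values R p y)"

lemma delta_eq:
  "delta_cochain scale_n bracket_e bracket_g \<iota> scale_v \<sigma> p f (map x [0..<2 * p]) =
    scale_v (1 / 2 ^ p) (alternation scale_v (2 * p) G x)"
  by (rule delta_cochain_eq[OF symmetric incl.dom.vector_space_axioms V.vector_space_axioms])

lemma linear_G:
  assumes k: "k < 2 * p"
  shows "Vector_Spaces.linear scale_g scale_v (\<lambda>a. G (z(k := a)))"
proof (cases "even k")
  case True
  then obtain m where m: "k = 2 * m" by blast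
  have "pair_values R p (z(k := a)) = (pair_values R p z)[m := R a (z (k + 1))]" for a
    using k m by (intro nth_equalityI) (auto simp: nth_list_update)
  moreover have "m < p" using k m by simp
  ultimately show ?thesis
    using Vector_Spaces.linear_compose[OF linear_curvature_left f_linear[of "pair_values R p z" m]]
    by (simp add: comp_def)
next
  case False
  then obtain m where m: "k = 2 * m + 1" by (blast elim: oddE)
  have "pair_values R p (z(k := a)) = (pair_values R p z)[m := R (z (2 * m)) a]" for a
    using k m by (intro nth_equalityI) (auto simp: nth_list_update)
  moreover have "m < p" using k m by simp
  ultimately show ?thesis
    using Vector_Spaces.linear_compose[OF linear_curvature_right f_linear[of "pair_values R p z" m]]
    by (simp add: comp_def)
qed

lemma delta_alternating:
  "delta_cochain scale_n bracket_e bracket_g \<iota> scale_v \<sigma> p f \<in> alternating_maps scale_g scale_v (2 * p)"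
proof (rule alternating_mapsI[where H = "\<lambda>x. scale_v (1 / 2 ^ p) (alternation scale_v (2 * p) G x)"])
  fix x k assume k: "k < 2 * p"
  show "Vector_Spaces.linear scale_g scale_v
      (\<lambda>a. scale_v (1 / 2 ^ p) (alternation scale_v (2 * p) G (x(k := a))))"
    using V.linear_alternation[OF linear_G k, of x]
    by (simp add: linear_iff_add_scale V.vector_space_axioms proj.cod.vector_space_axioms
        V.scale_right_distrib mult.commute)
next
  fix x i j assume "i < j" "j < 2 * p" "(x i :: 'g) = x j"
  then show "scale_v (1 / 2 ^ p) (alternation scale_v (2 * p) G x) = 0"
    by (simp add: V.alternation_eq_0)
qed (simp_all only: delta_eq, simp add: delta_cochain_def)

lemma G_block_swap: "m < p \<Longrightarrow> G (z \<circ> block_swap m) = G z"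
  by (simp add: pair_values_block_swap f_permute permutes_swap_id)

text \<open>G need not be alternating, but exchanging two pairs and exchanging the entries of the
  first pair together already carry slot 0 to every slot, with known sign.\<close>

lemma G_transpose_01:
  assumes "0 < p"
  shows "G (z \<circ> transpose 0 1) = - G z"
proof -
  have 1: "pair_values R p (z \<circ> transpose 0 1) = (pair_values R p z)[0 := - (pair_values R p z ! 0)]"
    using assms curvature_anti[of "z 1" "z 0"]
    by (intro nth_equalityI) (auto simp: nth_list_update transpose_def)
  interpret L: Vector_Spaces.linear scale_n scale_v "\<lambda>y. f ((pair_values R p z)[0 := y])"
    using assms by (intro f_linear) auto
  show ?thesis
    unfolding 1 L.neg by simp
qed

lemma act_zero: "act x 0 = 0"
  using mod.act_linear_right[of x] Vector_Spaces.linear_iff by (metis V.scale_zero_left)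

text \<open>
  The invariance of \<open>f\<close> turns \<open>act x\<close> into a sum over the \<open>p\<close> factors of the curvature power; they
  contribute equally because exchanging two factors is an even permutation of the arguments.
\<close>

lemma action_part:
  assumes "0 < p"
  shows "(\<Sum>j<Suc (2 * p). scale_v ((-1) ^ j) (act (x j) (alternation scale_v (2 * p) G (x \<circ> skip j)))) =
    scale_v (of_nat p) (alternation scale_v (Suc (2 * p))
      (\<lambda>y. f ((pair_values R p (y \<circ> Suc))[0 := conn (y 0) (R (y 1) (y 2))])) x)"
proof -
  define K where "K u i z = f ((pair_values R p z)[i := conn u (pair_values R p z ! i)])" for u i z
  have act_G: "act u (G z) = (\<Sum>i<p. K u i z)" for u z
    by (simp add: f_invariant K_def)
  have K: "K u i (z \<circ> block_swap i) = K u 0 z" if "i < p" for u i z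
  proof -
    have t: "transpose 0 i permutes {..<p}" using that by (intro permutes_swap_id) auto
    let ?l = "pair_values R p z"
    have "(permute_list (transpose 0 i) ?l)[i := conn u (permute_list (transpose 0 i) ?l ! i)] =
        permute_list (transpose 0 i) (?l[0 := conn u (?l ! 0)])"
      using t that by (intro nth_equalityI) (auto simp: permute_list_nth nth_list_update transpose_def)
    then show ?thesis
      using t that by (simp add: K_def pair_values_block_swap f_permute)
  qed
  have alt: "alternation scale_v (Suc (2 * p)) (\<lambda>y. K (y 0) i (y \<circ> Suc)) x =
      alternation scale_v (Suc (2 * p)) (\<lambda>y. K (y 0) 0 (y \<circ> Suc)) x" if "i < p" for i
  proof -
    let ?\<pi> = "suc_perm (block_swap i)"
    have b: "block_swap i permutes {..<2 * p}" by (rule block_swap_permutes[OF that])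
    have "K ((y \<circ> ?\<pi>) 0) i (y \<circ> ?\<pi> \<circ> Suc) = K (y 0) 0 (y \<circ> Suc)" for y
    proof -
      have "y \<circ> ?\<pi> \<circ> Suc = y \<circ> Suc \<circ> block_swap i" by (simp add: fun_eq_iff)
      then show ?thesis using K[OF that] by simp
    qed
    then show ?thesis
      using V.alternation_compose[OF suc_perm_permutes[OF b], of "\<lambda>y. K (y 0) i (y \<circ> Suc)" x]
      by (simp add: sign_suc_perm[OF b] sign_block_swap)
  qed
  \<comment> \<open>The Laplace expansion read backwards: the acting element x j becomes the first
    argument y 0 of one larger alternation.\<close>
  have "(\<Sum>j<Suc (2 * p). scale_v ((-1) ^ j) (act (x j) (alternation scale_v (2 * p) G (x \<circ> skip j)))) =
      alternation scale_v (Suc (2 * p)) (\<lambda>y. \<Sum>i<p. K (y 0) i (y \<circ> Suc)) x"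
    unfolding V.alternation_expand_first linear_alternation_eq[OF mod.act_linear_right] act_G
    by (simp add: comp_def del: sum.lessThan_Suc)
  also have "\<dots> = (\<Sum>i<p. alternation scale_v (Suc (2 * p)) (\<lambda>y. K (y 0) 0 (y \<circ> Suc)) x)"
    unfolding V.alternation_sum by (rule sum.cong) (simp, rule alt, simp)
  finally show ?thesis
    using assms by (simp add: V.sum_constant_scale K_def numeral_2_eq_2)
qed

text \<open>The bracket is first confined to slot 0, at the cost of the factor 2p; its two entries
  then become arguments of the large alternation through the expansion along two slots.\<close>

lemma bracket_part:
  assumes p: "p = Suc r"
  shows "scale_v 2 (\<Sum>j<Suc (2 * p). \<Sum>i<j. scale_v ((-1) ^ (i + j))
      (alternation scale_v (2 * p) G (case_nat (bracket_g (x i) (x j)) (x \<circ> skip j \<circ> skip i)))) =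
    - scale_v (of_nat (2 * p)) (alternation scale_v (Suc (2 * p))
        (\<lambda>y. G (case_nat (bracket_g (y 0) (y 1)) (y \<circ> Suc \<circ> Suc))) x)"
proof -
  let ?n = "2 * r + 1"
  have n: "2 * p = Suc ?n" by (simp add: p)
  \<comment> \<open>For k = 2m the pair exchange alone takes 0 to k; for k = 2m + 1 the exchange
    inside the first pair takes 0 to 1 beforehand.\<close>
  define \<pi> where "\<pi> k = block_swap (k div 2) \<circ> (if even k then id else transpose 0 1)" for k
  have column: "alternation scale_v (2 * p) G z =
      scale_v (of_nat (2 * p)) (alternation scale_v ?n (\<lambda>y. G (case_nat (z 0) y)) (z \<circ> Suc))" for z
    unfolding n
  proof (rule V.alternation_fix_first[where \<pi> = \<pi>])
    fix k assume k: "k < Suc ?n"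
    then have m: "k div 2 < p" by (simp add: p)
    have b: "block_swap (k div 2) permutes {..<Suc ?n}"
      using block_swap_permutes[OF m] n by simp
    have t: "transpose 0 1 permutes {..<Suc ?n}" by (intro permutes_swap_id) auto
    show "\<pi> k permutes {..<Suc ?n}"
      unfolding \<pi>_def using b t by (auto intro: permutes_compose permutes_id simp del: lessThan_Suc)
    show "\<pi> k 0 = k"
      by (auto simp: \<pi>_def)
    fix z
    show "G (z \<circ> \<pi> k) = scale_v (of_int (sign (\<pi> k))) (G z)"
    proof (cases "even k")
      case True
      then show ?thesis using m by (simp add: \<pi>_def G_block_swap sign_block_swap)
    next
      case False
      have "sign (\<pi> k) = -1"
        using sign_compose_permutes[OF finite_lessThan b t] False
        by (simp add: \<pi>_def sign_block_swap sign_swap_id)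
      moreover have "G (z \<circ> \<pi> k) = - G z"
        using False m G_transpose_01[of "z \<circ> block_swap (k div 2)"] by (simp add: \<pi>_def G_block_swap comp_assoc)
      ultimately show ?thesis by simp
    qed
  qed
  let ?F = "\<lambda>y. G (case_nat (bracket_g (y 0) (y 1)) (y \<circ> Suc \<circ> Suc))"
  have anti: "?F (case_nat a (case_nat b y)) = - ?F (case_nat b (case_nat a y))" for a b y
  proof -
    \<comment> \<open>The entry 0 is a placeholder that the update overwrites; linearity in slot 0
      lets the sign of the bracket pass through G.\<close>
    interpret L: Vector_Spaces.linear scale_g scale_v "\<lambda>c. G ((case_nat 0 y)(0 := c))"
      by (rule linear_G) (simp add: p)
    have c: "(case_nat 0 y)(0 := c) = case_nat c y" for c
      by (auto simp: fun_eq_iff split: nat.split)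
    show ?thesis
      using L.neg[of "bracket_g b a"] proj.cod.bracket_anti[of a b] by (simp add: c comp_def)
  qed
  let ?T = "\<Sum>j<Suc (2 * p). \<Sum>i<j. scale_v ((-1) ^ (i + j))
      (alternation scale_v ?n (\<lambda>y. ?F (case_nat (x i) (case_nat (x j) y))) (x \<circ> skip j \<circ> skip i))"
  have S: "(\<Sum>j<Suc (2 * p). \<Sum>i<j. scale_v ((-1) ^ (i + j))
      (alternation scale_v (2 * p) G (case_nat (bracket_g (x i) (x j)) (x \<circ> skip j \<circ> skip i)))) =
    scale_v (of_nat (2 * p)) ?T"
    unfolding column by (simp add: V.scale_sum_right comp_def mult.commute del: sum.lessThan_Suc of_nat_Suc)
  have T: "scale_v 2 ?T = - alternation scale_v (Suc (2 * p)) ?F x"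
    unfolding n by (rule V.alternation_expand_first_two[where F = ?F], rule anti)
  show ?thesis
    unfolding S by (subst V.scale_left_commute) (simp only: T V.scale_minus_right)
qed

lemma alternation_bianchi:
  assumes p: "p = Suc r"
  shows "alternation scale_v (Suc (2 * p))
      (\<lambda>y. f ((pair_values R p (y \<circ> Suc))[0 := conn (y 0) (R (y 1) (y 2))]) -
        G (case_nat (bracket_g (y 0) (y 1)) (y \<circ> Suc \<circ> Suc))) x = 0"
proof -
  \<comment> \<open>In both terms the arguments 0, 1, 2 enter the first factor only, so the other r
    = p - 1 factors start at argument 3 and form a common tail.\<close>
  let ?t = "\<lambda>y. pair_values R r (\<lambda>i. y (i + 3))"
  define B where "B a b c = conn a (R b c) - R (bracket_g a b) c" for a b c
  define K where "K y = f (B (y 0) (y 1) (y 2) # ?t y)" for y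
  define \<rho> :: "nat \<Rightarrow> nat" where "\<rho> = transpose 0 1 \<circ> transpose 1 2"
  have \<rho>: "\<rho> permutes {..<Suc (2 * p)}"
    unfolding \<rho>_def p by (intro permutes_compose permutes_swap_id) auto
  have \<rho>_simps: "\<rho> 0 = 1" "\<rho> 1 = 2" "\<rho> 2 = 0" "\<rho> (i + 3) = i + 3" for i
    by (auto simp: \<rho>_def transpose_def)
  have sgn: "sign \<rho> = 1"
    by (simp add: \<rho>_def sign_compose permutation_swap_id sign_swap_id)
  have lin: "Vector_Spaces.linear scale_n scale_v (\<lambda>y. f (y # l))" if "length l = r" for l
    using f_linear[of "0 # l" 0] that by (simp add: p)
  have tail1: "(pair_values R p (y \<circ> Suc))[0 := a] = a # ?t y" for y a
    by (rule nth_equalityI) (auto simp: p nth_Cons numeral_3_eq_3 split: nat.split)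
  have tail2: "pair_values R p (case_nat a (y \<circ> Suc \<circ> Suc)) = R a (y 2) # ?t y" for y a
    by (rule nth_equalityI) (auto simp: p nth_Cons numeral_3_eq_3 numeral_2_eq_2 split: nat.split)
  have K_eq: "f ((pair_values R p (y \<circ> Suc))[0 := conn (y 0) (R (y 1) (y 2))]) -
        G (case_nat (bracket_g (y 0) (y 1)) (y \<circ> Suc \<circ> Suc)) = K y" for y
  proof -
    interpret L: Vector_Spaces.linear scale_n scale_v "\<lambda>a. f (a # ?t y)" by (rule lin) simp
    show ?thesis unfolding tail1 tail2 K_def B_def L.diff ..
  qed
  have cyc: "K y + K (y \<circ> \<rho>) + K (y \<circ> \<rho> \<circ> \<rho>) = 0" for y
  proof -
    interpret L: Vector_Spaces.linear scale_n scale_v "\<lambda>a. f (a # ?t y)" by (rule lin) simp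
    have "K y + K (y \<circ> \<rho>) + K (y \<circ> \<rho> \<circ> \<rho>) =
        f ((B (y 0) (y 1) (y 2) + B (y 1) (y 2) (y 0) + B (y 2) (y 0) (y 1)) # ?t y)"
      by (simp add: K_def \<rho>_simps[simplified] L.add)
    also have "B (y 0) (y 1) (y 2) + B (y 1) (y 2) (y 0) + B (y 2) (y 0) (y 1) = 0"
      unfolding B_def by (rule bianchi)
    finally show ?thesis by (simp only: L.zero)
  qed
  let ?A = "alternation scale_v (Suc (2 * p))"
  have shift: "?A (\<lambda>y. F (y \<circ> \<rho>)) x = ?A F x" for F
    using V.alternation_compose[OF \<rho>] by (simp add: sgn)
  \<comment> \<open>The three rotations of K have the same alternation, and their sum is zero; 3 is
    invertible in characteristic 0.\<close>
  have "?A K x + ?A K x + ?A K x = ?A (\<lambda>y. K y + K (y \<circ> \<rho>) + K (y \<circ> \<rho> \<circ> \<rho>)) x"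
    by (simp only: V.alternation_add shift[of K] shift[of "\<lambda>y. K (y \<circ> \<rho>)"])
  also have "\<dots> = 0" by (simp only: cyc V.alternation_zero)
  finally have "scale_v (1 + 1 + 1) (?A K x) = 0"
    by (simp only: V.scale_left_distrib V.scale_one)
  then show ?thesis unfolding K_eq by simp
qed

lemma delta_closed:
  "ce_differential bracket_g scale_v act (delta_cochain scale_n bracket_e bracket_g \<iota> scale_v \<sigma> p f) = (\<lambda>_. 0)"
proof
  fix xs :: "'g list"
  let ?\<Delta> = "delta_cochain scale_n bracket_e bracket_g \<iota> scale_v \<sigma> p f"
  show "ce_differential bracket_g scale_v act ?\<Delta> xs = 0"
  proof (cases "length xs = Suc (2 * p)")
    case False
    show ?thesis
      by (rule ce_differential_eq_0_of_length[where n = "2 * p"])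
        (simp_all add: delta_cochain_def False V.vector_space_axioms act_zero)
  next
    case True
    define x where "x = (!) xs"
    have xs: "xs = map x [0..<Suc (2 * p)]" using map_nth[of xs] True by (simp add: x_def)
    let ?S1 = "\<Sum>j<Suc (2 * p). scale_v ((-1) ^ j) (act (x j) (alternation scale_v (2 * p) G (x \<circ> skip j)))"
    let ?S2 = "\<Sum>j<Suc (2 * p). \<Sum>i<j. scale_v ((-1) ^ (i + j))
      (alternation scale_v (2 * p) G (case_nat (bracket_g (x i) (x j)) (x \<circ> skip j \<circ> skip i)))"
    have act_scale: "act u (scale_v c v) = scale_v c (act u v)" for u c v
      using mod.act_linear_right[of u] by (simp add: Vector_Spaces.linear_iff)
    have "ce_differential bracket_g scale_v act ?\<Delta> xs = scale_v (1 / 2 ^ p) (?S1 + ?S2)"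
      unfolding xs ce_differential_map_upt[where
          H = "\<lambda>x. scale_v (1 / 2 ^ p) (alternation scale_v (2 * p) G x)", OF delta_eq]
      by (simp add: act_scale V.scale_right_distrib V.scale_sum_right mult.commute del: sum.lessThan_Suc)
    also have "?S1 + ?S2 = 0"
    proof (cases p)
      case 0
      \<comment> \<open>Invariance at the empty list equates the action on \<open>f []\<close> with
        an empty sum, and no pair i < j exists.\<close>
      then show ?thesis using f_invariant[of "[]"] by (simp add: alternation_def pair_values_def)
    next
      case (Suc r)
      let ?A = "alternation scale_v (Suc (2 * p))"
        and ?F1 = "\<lambda>y. f ((pair_values R p (y \<circ> Suc))[0 := conn (y 0) (R (y 1) (y 2))])"
        and ?F2 = "\<lambda>y. G (case_nat (bracket_g (y 0) (y 1)) (y \<circ> Suc \<circ> Suc))"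
      have S1: "?S1 = scale_v (of_nat p) (?A ?F1 x)"
        by (rule action_part) (simp add: Suc)
      \<comment> \<open>Doubling matches \<open>bracket_part\<close>; the 2 is cancelled at the
        end.\<close>
      have "scale_v 2 (?S1 + ?S2) = scale_v 2 (scale_v (of_nat p) (?A ?F1 x)) - scale_v (of_nat (2 * p)) (?A ?F2 x)"
        unfolding V.scale_right_distrib S1 bracket_part[OF Suc] by (rule add_uminus_conv_diff)
      also have "\<dots> = scale_v (of_nat (2 * p)) (?A (\<lambda>y. ?F1 y - ?F2 y) x)"
        by (simp add: V.alternation_diff V.scale_right_diff_distrib)
      also have "\<dots> = 0" by (simp only: alternation_bianchi[OF Suc] V.scale_zero_right)
      finally show ?thesis by simp
    qed
    finally show ?thesis by simp
  qed
qed

end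

end

section \<open>The induced map to cohomology\<close>

lemma cohomology_class_in_cohomology:
  "\<omega> \<in> cocycles scale_g bracket_g scale_v act p \<Longrightarrow>
    cohomology_class scale_g bracket_g scale_v act p \<omega> \<in> cohomology scale_g bracket_g scale_v act p"
  unfolding cohomology_class_def cohomology_def by (rule quotientI)

theorem corollary5p2:
  fixes scale_n :: "'k::real_or_complex \<Rightarrow> 'n::ab_group_add \<Rightarrow> 'n" and bracket_n :: "'n \<Rightarrow> 'n \<Rightarrow> 'n"
    and scale_e :: "'k \<Rightarrow> 'e::ab_group_add \<Rightarrow> 'e" and bracket_e :: "'e \<Rightarrow> 'e \<Rightarrow> 'e"
    and scale_g :: "'k \<Rightarrow> 'g::ab_group_add \<Rightarrow> 'g" and bracket_g :: "'g \<Rightarrow> 'g \<Rightarrow> 'g"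
    and \<iota> :: "'n \<Rightarrow> 'e" and q :: "'e \<Rightarrow> 'g" and \<sigma> :: "'g \<Rightarrow> 'e"
    and scale_v :: "'k \<Rightarrow> 'v::ab_group_add \<Rightarrow> 'v" and act :: "'g \<Rightarrow> 'v \<Rightarrow> 'v"
    and p :: nat
  assumes "lie_extension scale_n bracket_n scale_e bracket_e scale_g bracket_g \<iota> q"
    and "lie_module scale_g bracket_g scale_v act"
    and "linear_section scale_g scale_e q \<sigma>"
  shows "(\<forall>f \<in> invariant_symmetric_maps scale_n bracket_e \<iota> scale_v act \<sigma> p.
            delta_cochain scale_n bracket_e bracket_g \<iota> scale_v \<sigma> p f
              \<in> alternating_maps scale_g scale_v (2 * p) \<and>
            ce_differential bracket_g scale_v act
              (delta_cochain scale_n bracket_e bracket_g \<iota> scale_v \<sigma> p f) = (\<lambda>_. 0) \<and>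
            delta_cochain scale_n bracket_e bracket_g \<iota> scale_v \<sigma> p f
              \<in> cocycles scale_g bracket_g scale_v act (2 * p) \<and>
            cohomology_class scale_g bracket_g scale_v act (2 * p)
              (delta_cochain scale_n bracket_e bracket_g \<iota> scale_v \<sigma> p f)
              \<in> cohomology scale_g bracket_g scale_v act (2 * p))
       \<and> (\<lambda>f \<in> invariant_symmetric_maps scale_n bracket_e \<iota> scale_v act \<sigma> p.
            cohomology_class scale_g bracket_g scale_v act (2 * p)
              (delta_cochain scale_n bracket_e bracket_g \<iota> scale_v \<sigma> p f))
           \<in> invariant_symmetric_maps scale_n bracket_e \<iota> scale_v act \<sigma> p
               \<rightarrow>\<^sub>E cohomology scale_g bracket_g scale_v act (2 * p)"
proof -
  interpret E: extension_with_section scale_n bracket_n scale_e bracket_e scale_g bracket_g \<iota> q scale_v act \<sigma>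
    using assms by (simp add: extension_with_section_def extension_with_section_axioms_def)
  have cocycle: "delta_cochain scale_n bracket_e bracket_g \<iota> scale_v \<sigma> p f \<in> cocycles scale_g bracket_g scale_v act (2 * p)"
    if "f \<in> invariant_symmetric_maps scale_n bracket_e \<iota> scale_v act \<sigma> p" for f
    using E.delta_alternating[OF that] E.delta_closed[OF that] by (simp add: cocycles_def)
  then show ?thesis
    unfolding restrict_PiE_iff
    by (intro conjI ballI cohomology_class_in_cohomology E.delta_alternating E.delta_closed)
qed

end
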